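(* Let $n\ge 3$ and let $e,f$ be two distinct edges of the complete graph $K_n$ sharing a vertex. Let the edge weights of $K_n$ be independent with one common atomless law on $\mathbb{R}$, let $T$ be the almost surely unique minimum spanning tree, and put $p_1=\mathbf{P}(e\in T,\ f\in T)$ and $p_0=\mathbf{P}(e\in T)=\frac{2}{n}$. Then $$p_1<p_0^2=\frac{4}{n^2}.$$
   Context: By symmetry of $K_n$, every edge has the same inclusion probability $p_0=(n-1)/\binom n2=2/n$, and $p_1$ does not depend on the choice of the pair of adjacent edges. The law of $T$ does not depend on the choice of the common atomless weight law. *)

theory Defs
  imports "HOL-Probability.Probability"
begin

text \<open>
  A simple graph is given by a vertex set \<open>V\<close> and a set \<open>E\<close> of two-element subsets of \<open>V\<close>.
  The spanning trees of the AFP entry \<open>Graph_Theory\<close> are not used: its forests exclude directed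
  cycles, so that no symmetric digraph with an edge is a forest there.
\<close>

definition complete_edges :: "'v set \<Rightarrow> 'v set set" where
  "complete_edges V = {e. e \<subseteq> V \<and> card e = 2}"

definition graph_connected :: "'v set \<Rightarrow> 'v set set \<Rightarrow> bool" where
  "graph_connected V E \<longleftrightarrow>
     V \<noteq> {} \<and> (\<forall>u\<in>V. \<forall>v\<in>V. (u, v) \<in> {(x, y). {x, y} \<in> E}\<^sup>*)"

definition graph_cycle :: "'v set set \<Rightarrow> 'v list \<Rightarrow> bool" where
  "graph_cycle E c \<longleftrightarrow> 3 \<le> length c \<and> distinct c \<and>
     (\<forall>i < length c. {c ! i, c ! (Suc i mod length c)} \<in> E)"

definition graph_tree :: "'v set \<Rightarrow> 'v set set \<Rightarrow> bool" where
  "graph_tree V T \<longleftrightarrow> T \<subseteq> complete_edges V \<and> graph_connected V T \<and> (\<nexists>c. graph_cycle T c)"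

definition spanning_tree :: "'v set \<Rightarrow> 'v set set \<Rightarrow> 'v set set \<Rightarrow> bool" where
  "spanning_tree V E T \<longleftrightarrow> T \<subseteq> E \<and> graph_tree V T"

definition is_mst :: "'v set \<Rightarrow> 'v set set \<Rightarrow> ('v set \<Rightarrow> real) \<Rightarrow> 'v set set \<Rightarrow> bool" where
  "is_mst V E w T \<longleftrightarrow> spanning_tree V E T \<and>
     (\<forall>T'. spanning_tree V E T' \<longrightarrow> (\<Sum>g\<in>T. w g) \<le> (\<Sum>g\<in>T'. w g))"

text \<open>
  Only meaningful where the minimum spanning tree is unique. Where it is not, the value is still
  determined by the finite set of all minimum spanning trees, so that, for finite \<open>V\<close>, events
  about \<open>mst\<close> of random weights are measurable.
\<close>

definition mst :: "'v set \<Rightarrow> 'v set set \<Rightarrow> ('v set \<Rightarrow> real) \<Rightarrow> 'v set set" where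
  "mst V E w = (THE T. is_mst V E w T)"

end

theory Submission
  imports Defs "HOL-Combinatorics.Multiset_Permutations"
begin

text \<open>
  Almost surely the weights are distinct, every order of the edges is then equally likely, and the
  minimum spanning tree is what Kruskal's algorithm accepts. By symmetry \<open>p\<^sub>1\<close> is the mean number of
  ordered pairs of adjacent tree edges divided by \<open>n (n - 1) (n - 2)\<close>. Given the forest accepted so
  far, the next accepted edge is uniform among the edges between different components, and accepting
  \<open>xy\<close> creates \<open>2 (deg x + deg y)\<close> new pairs. As a component \<open>C\<close> is a tree, its degrees sum to
  \<open>2 (card C - 1)\<close>, so the mean number of new pairs depends on the component sizes \<open>c\<^sub>1, \<dots>, c\<^sub>m\<close> only:
  it is \<open>8 - 8 n (m - 1) / (n\<^sup>2 - \<Sum>c\<^sub>i\<^sup>2)\<close>, which by Cauchy--Schwarz is at most \<open>8 - 8 m / n\<close>. Summing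
  over \<open>m = 2, \<dots>, n\<close> gives \<open>4 (n - 1) (n - 2) / n\<close>, that is \<open>p\<^sub>1 \<le> 4 / n\<^sup>2\<close>. The inequality is strict
  since \<open>n - 1\<close> components never have equal sizes.
\<close>

section \<open>Connectivity and forests\<close>

definition conn :: "'v set set \<Rightarrow> ('v \<times> 'v) set" where
  "conn E = {(x, y). {x, y} \<in> E}\<^sup>*"

text \<open>Acyclicity in the form that every edge is a bridge, which suits insertion and deletion
  of edges; \<open>acyclic_iff_forest\<close> relates it to \<open>graph_cycle\<close>.\<close>

definition forest :: "'v set set \<Rightarrow> bool" where
  "forest T \<longleftrightarrow> (\<forall>u v. {u, v} \<in> T \<longrightarrow> (u, v) \<notin> conn (T - {{u, v}}))"

lemma conn_refl [simp]: "(x, x) \<in> conn E"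
  by (simp add: conn_def)

lemma conn_trans: "(x, y) \<in> conn E \<Longrightarrow> (y, z) \<in> conn E \<Longrightarrow> (x, z) \<in> conn E"
  unfolding conn_def by (rule rtrancl_trans)

lemma conn_edge: "{x, y} \<in> E \<Longrightarrow> (x, y) \<in> conn E"
  unfolding conn_def by blast

lemma conn_sym: "(x, y) \<in> conn E \<Longrightarrow> (y, x) \<in> conn E"
proof -
  have "sym {(x, y). {x, y} \<in> E}"
    by (auto simp: sym_def insert_commute)
  then show "(x, y) \<in> conn E \<Longrightarrow> (y, x) \<in> conn E"
    unfolding conn_def by (meson sym_rtrancl symD)
qed

lemma conn_subset:
  assumes "\<And>x y. {x, y} \<in> E \<Longrightarrow> (x, y) \<in> conn E'"
  shows "conn E \<subseteq> conn E'"
  using assms unfolding conn_def by (intro rtrancl_subset_rtrancl) auto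

lemma conn_mono: "E \<subseteq> E' \<Longrightarrow> conn E \<subseteq> conn E'"
  by (rule conn_subset) (auto intro: conn_edge)

text \<open>A walk through the new edge can be shortened until it uses that edge at most once, in
  one of its two directions.\<close>

lemma conn_insert:
  "(x, y) \<in> conn (insert {u, v} E) \<longleftrightarrow>
     (x, y) \<in> conn E \<or> (x, u) \<in> conn E \<and> (v, y) \<in> conn E \<or> (x, v) \<in> conn E \<and> (u, y) \<in> conn E"
  (is "?L \<longleftrightarrow> ?R x y")
proof
  assume "(x, y) \<in> conn (insert {u, v} E)"
  then show "?R x y"
    unfolding conn_def
  proof (induction rule: rtrancl_induct)
    case base
    then show ?case by simp
  next
    case (step y z)
    have IH: "?R x y" using step.IH by (simp add: conn_def)
    from step.hyps(2) consider "{y, z} \<in> E" | "y = u" "z = v" | "y = v" "z = u"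
      by (auto simp: doubleton_eq_iff)
    then have "?R x z"
    proof cases
      case 1
      then show ?thesis using IH conn_edge[OF 1] by (blast intro: conn_trans)
    next
      case 2
      then show ?thesis using IH by auto
    next
      case 3
      then show ?thesis using IH by auto
    qed
    then show ?case by (simp add: conn_def)
  qed
next
  assume R: "?R x y"
  have "conn E \<subseteq> conn (insert {u, v} E)" by (rule conn_mono) auto
  moreover have "(u, v) \<in> conn (insert {u, v} E)" by (rule conn_edge) simp
  moreover have "(v, u) \<in> conn (insert {u, v} E)" by (rule conn_edge) (simp add: insert_commute)
  ultimately show ?L using R by (meson conn_trans subsetD)
qed

lemma conn_insert_redundant:
  "(u, v) \<in> conn E \<Longrightarrow> conn (insert {u, v} E) = conn E"
  by (auto simp: conn_insert) (meson conn_sym conn_trans)+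

section \<open>Edges of the complete graph, cycles and bridges\<close>

lemma complete_edgesD:
  assumes "g \<in> complete_edges V"
  obtains u v where "g = {u, v}" "u \<in> V" "v \<in> V" "u \<noteq> v"
  using assms unfolding complete_edges_def by (auto simp: card_2_iff)

lemma doubleton_in_complete_edges [simp]:
  "{u, v} \<in> complete_edges V \<longleftrightarrow> u \<in> V \<and> v \<in> V \<and> u \<noteq> v"
  by (cases "u = v") (auto simp: complete_edges_def)

lemma finite_complete_edges: "finite V \<Longrightarrow> finite (complete_edges V)"
  by (rule finite_subset[of _ "Pow V"]) (auto simp: complete_edges_def)

text \<open>Extend a simple path by the next vertex; if that vertex already occurs, cut the path
  back to this occurrence instead.\<close>

lemma rtrancl_distinct_path:
  assumes "(u, v) \<in> r\<^sup>*"
  shows "\<exists>p. p \<noteq> [] \<and> hd p = u \<and> last p = v \<and> distinct p \<and>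
    (\<forall>i. Suc i < length p \<longrightarrow> (p ! i, p ! Suc i) \<in> r)"
  using assms
proof (induction rule: rtrancl_induct)
  case base
  show ?case by (rule exI[of _ "[u]"]) simp
next
  case (step y z)
  then obtain p where p: "p \<noteq> []" "hd p = u" "last p = y" "distinct p"
    "\<And>i. Suc i < length p \<Longrightarrow> (p ! i, p ! Suc i) \<in> r" by auto
  show ?case
  proof (cases "z \<in> set p")
    case True
    then obtain j where j: "j < length p" "p ! j = z" by (auto simp: in_set_conv_nth)
    have "last (take (Suc j) p) = z"
      using j by (simp add: take_Suc_conv_app_nth)
    then show ?thesis
      using p j by (intro exI[of _ "take (Suc j) p"]) (auto simp: hd_take)
  next
    case False
    have "((p @ [z]) ! i, (p @ [z]) ! Suc i) \<in> r" if "Suc i < length (p @ [z])" for i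
    proof (cases "Suc i < length p")
      case True
      then show ?thesis using p(5)[of i] by (simp add: nth_append)
    next
      case False
      then have "i = length p - 1" "Suc i = length p" using that by auto
      then show ?thesis using p(1,3) step.hyps(2) by (simp add: nth_append last_conv_nth)
    qed
    then show ?thesis
      using p False by (intro exI[of _ "p @ [z]"]) auto
  qed
qed

text \<open>An edge that is not a bridge closes a simple path between its ends to a cycle;
  conversely, a cycle without its closing edge still connects the ends of that edge.\<close>

lemma acyclic_iff_forest:
  assumes "T \<subseteq> complete_edges V"
  shows "(\<nexists>c. graph_cycle T c) \<longleftrightarrow> forest T"
proof
  assume acyc: "\<nexists>c. graph_cycle T c"
  show "forest T"
    unfolding forest_def
  proof (intro allI impI notI)
    fix u v assume uv: "{u, v} \<in> T" and c: "(u, v) \<in> conn (T - {{u, v}})"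
    obtain p where p: "p \<noteq> []" "hd p = u" "last p = v" "distinct p"
      "\<And>i. Suc i < length p \<Longrightarrow> {p ! i, p ! Suc i} \<in> T - {{u, v}}"
      using rtrancl_distinct_path[OF c[unfolded conn_def]] by auto
    have "u \<noteq> v" using subsetD[OF assms uv] by simp
    have 0: "p ! 0 = u" and l: "p ! (length p - 1) = v"
      using p(1-3) by (simp_all add: hd_conv_nth last_conv_nth)
    \<comment> \<open>One vertex would give \<open>u = v\<close>, and two vertices would make the
      removed edge the only step.\<close>
    have "length p \<noteq> 1" using 0 l \<open>u \<noteq> v\<close> by auto
    moreover have "length p \<noteq> 2" using 0 l p(5)[of 0] by auto
    moreover have "length p \<noteq> 0" using p(1) by simp
    ultimately have 3: "3 \<le> length p" by linarith
    have "{p ! i, p ! (Suc i mod length p)} \<in> T" if "i < length p" for i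
    proof (cases "Suc i < length p")
      case True
      then show ?thesis using p(5)[of i] by simp
    next
      case False
      then have "i = length p - 1" "Suc i = length p" using that by auto
      then show ?thesis using 0 l uv by (simp add: insert_commute)
    qed
    then have "graph_cycle T p" using 3 p(4) by (simp add: graph_cycle_def)
    then show False using acyc by blast
  qed
next
  assume fo: "forest T"
  show "\<nexists>c. graph_cycle T c"
  proof
    assume "\<exists>c. graph_cycle T c"
    then obtain c where c: "3 \<le> length c" "distinct c"
      "\<And>i. i < length c \<Longrightarrow> {c ! i, c ! (Suc i mod length c)} \<in> T"
      by (auto simp: graph_cycle_def)
    let ?l = "length c - 1"
    let ?h = "{c ! 0, c ! ?l}"
    have h: "?h \<in> T" using c(3)[of ?l] c(1) by (cases "length c") (auto simp: insert_commute)
    have "(c ! 0, c ! i) \<in> conn (T - {?h})" if "i \<le> ?l" for i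
      using that
    proof (induction i)
      case 0
      show ?case by simp
    next
      case (Suc i)
      have "{c ! i, c ! Suc i} \<in> T" using c(3)[of i] Suc.prems c(1) by simp
      moreover have "{c ! i, c ! Suc i} \<noteq> ?h"
      proof
        assume "{c ! i, c ! Suc i} = ?h"
        moreover have "i < length c" "Suc i < length c" "0 < length c" "?l < length c" "i \<noteq> ?l"
          using Suc.prems c(1) by linarith+
        ultimately have "i = 0 \<and> Suc i = ?l"
          using c(2) by (metis doubleton_eq_iff nth_eq_iff_index_eq)
        then show False using c(1) by linarith
      qed
      ultimately have "(c ! i, c ! Suc i) \<in> conn (T - {?h})" by (intro conn_edge) simp
      then show ?case using Suc conn_trans[of "c ! 0" "c ! i"] by simp
    qed
    then have "(c ! 0, c ! ?l) \<in> conn (T - {?h})" by simp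
    then show False using fo h unfolding forest_def by blast
  qed
qed

text \<open>If an edge \<open>{a, b}\<close> of \<open>F\<close> stopped being a bridge, the detour
  between its ends would run through \<open>{u, v}\<close>; together with \<open>{a, b}\<close> the
  rest of the detour would connect \<open>u\<close> with \<open>v\<close> inside
  \<open>F\<close>.\<close>

lemma forest_insert:
  assumes "forest F" and "(u, v) \<notin> conn F"
  shows "forest (insert {u, v} F)"
  unfolding forest_def
proof (intro allI impI notI)
  fix a b
  assume ab: "{a, b} \<in> insert {u, v} F"
    and c: "(a, b) \<in> conn (insert {u, v} F - {{a, b}})"
  have uvF: "{u, v} \<notin> F" using assms(2) conn_edge[of u v F] by auto
  show False
  proof (cases "{a, b} = {u, v}")
    case True
    then have "(a, b) \<in> conn F" using c uvF by simp
    moreover from this have "(b, a) \<in> conn F" by (rule conn_sym)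

    ultimately show False using True assms(2) by (auto simp: doubleton_eq_iff)
  next
    case False
    let ?F = "F - {{a, b}}"
    have abF: "{a, b} \<in> F" using ab False by simp
    then have no: "(a, b) \<notin> conn ?F" using assms(1) by (simp add: forest_def)
    have "insert {u, v} F - {{a, b}} = insert {u, v} ?F" using False by auto
    then have "(a, u) \<in> conn ?F \<and> (v, b) \<in> conn ?F \<or> (a, v) \<in> conn ?F \<and> (u, b) \<in> conn ?F"
      using c no by (simp add: conn_insert)
    then have "(a, u) \<in> conn F \<and> (v, b) \<in> conn F \<or> (a, v) \<in> conn F \<and> (u, b) \<in> conn F"
      using conn_mono[of ?F F] by blast
    moreover note conn_edge[OF abF]
    ultimately have "(u, v) \<in> conn F" by (meson conn_sym conn_trans)
    then show False using assms(2) by simp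
  qed
qed

lemma forest_subset: "forest T \<Longrightarrow> S \<subseteq> T \<Longrightarrow> forest S"
  unfolding forest_def by (meson Diff_mono conn_mono order_refl subsetD)

section \<open>Spanning trees of the complete graph\<close>

lemma spanning_tree_iff:
  assumes "V \<noteq> {}"
  shows "spanning_tree V (complete_edges V) T \<longleftrightarrow>
    T \<subseteq> complete_edges V \<and> V \<times> V \<subseteq> conn T \<and> forest T"
  using assms acyclic_iff_forest[of T V]
  by (auto simp: spanning_tree_def graph_tree_def graph_connected_def conn_def)

text \<open>Without \<open>{a, b}\<close> the tree falls into two parts. As \<open>u\<close> and
  \<open>v\<close> lie in different parts, \<open>{u, v}\<close> joins these again and closes no
  cycle.\<close>

lemma spanning_tree_exchange:
  assumes T: "spanning_tree V (complete_edges V) T" and "V \<noteq> {}"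
    and h: "{a, b} \<in> T" and g: "{u, v} \<in> complete_edges V"
    and uv: "(u, v) \<notin> conn (T - {{a, b}})"
  shows "spanning_tree V (complete_edges V) (insert {u, v} (T - {{a, b}}))"
proof -
  let ?S = "T - {{a, b}}"
  have T': "T \<subseteq> complete_edges V" "V \<times> V \<subseteq> conn T" "forest T"
    using T spanning_tree_iff[OF \<open>V \<noteq> {}\<close>] by auto
  have ins: "insert {a, b} ?S = T" using h by auto
  have "(u, v) \<in> conn (insert {a, b} ?S)" unfolding ins using T'(2) g by auto
  then have "(u, a) \<in> conn ?S \<and> (b, v) \<in> conn ?S \<or> (u, b) \<in> conn ?S \<and> (a, v) \<in> conn ?S"
    using uv unfolding conn_insert by blast
  then have "(a, b) \<in> conn (insert {u, v} ?S)"
    unfolding conn_insert by (meson conn_sym)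
  then have "conn (insert {a, b} (insert {u, v} ?S)) = conn (insert {u, v} ?S)"
    by (rule conn_insert_redundant)
  moreover have "conn T \<subseteq> conn (insert {a, b} (insert {u, v} ?S))" by (rule conn_mono) auto
  moreover have "forest (insert {u, v} ?S)"
    by (rule forest_insert[OF forest_subset[OF T'(3)] uv]) auto
  ultimately show ?thesis
    using T' g unfolding spanning_tree_iff[OF \<open>V \<noteq> {}\<close>] by auto
qed

text \<open>A minimal edge set connecting \<open>V\<close> is a forest, because an edge that is not
  a bridge could be dropped.\<close>

lemma spanning_tree_exists:
  assumes "finite V" and "V \<noteq> {}"
  shows "\<exists>T. spanning_tree V (complete_edges V) T"
proof -
  let ?K = "complete_edges V"
  let ?A = "{T. T \<subseteq> ?K \<and> V \<times> V \<subseteq> conn T}"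
  have "(x, y) \<in> conn ?K" if "x \<in> V" "y \<in> V" for x y
    using that by (cases "x = y") (auto intro: conn_edge)
  then have "?K \<in> ?A" by auto
  moreover have "finite ?A"
    by (rule finite_subset[of _ "Pow ?K"]) (auto simp: finite_complete_edges[OF assms(1)])
  ultimately obtain T where T: "T \<in> ?A" "\<And>S. S \<in> ?A \<Longrightarrow> S \<subseteq> T \<Longrightarrow> S = T"
    by (metis (no_types, lifting) finite_has_minimal empty_iff)
  have "forest T"
    unfolding forest_def
  proof (intro allI impI notI)
    fix u v assume uv: "{u, v} \<in> T" and c: "(u, v) \<in> conn (T - {{u, v}})"
    have "conn T = conn (T - {{u, v}})"
      using conn_insert_redundant[OF c] uv by (simp add: insert_absorb)
    then have "T - {{u, v}} \<in> ?A" using T(1) by auto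
    then show False using T(2)[of "T - {{u, v}}"] uv by auto
  qed
  then show ?thesis using T(1) unfolding spanning_tree_iff[OF assms(2)] by auto
qed

section \<open>Minimum spanning trees and Kruskal's algorithm\<close>

text \<open>Kruskal's acceptance test. Quantifying over both namings of the ends avoids choosing an
  order of them.\<close>

definition cross :: "'v set set \<Rightarrow> 'v set \<Rightarrow> bool" where
  "cross E g \<longleftrightarrow> (\<forall>u v. g = {u, v} \<longrightarrow> (u, v) \<notin> conn E)"

lemma cross_doubleton [simp]: "cross E {u, v} \<longleftrightarrow> (u, v) \<notin> conn E"
  by (auto simp: cross_def doubleton_eq_iff dest: conn_sym)

lemma not_cross_if_mem:
  assumes "g \<in> complete_edges V" and "g \<in> E"
  shows "\<not> cross E g"
  using assms by (elim complete_edgesD) (auto intro: conn_edge)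

text \<open>The output of Kruskal's algorithm for distinct weights, described without an order: the
  test against all lighter edges agrees with the test against the accepted ones, since both sets
  have the same components.\<close>

definition kruskal_tree :: "'v set \<Rightarrow> ('v set \<Rightarrow> real) \<Rightarrow> 'v set set" where
  "kruskal_tree V w = {g \<in> complete_edges V. cross {h \<in> complete_edges V. w h < w g} g}"

lemma mst_exchange_le:
  assumes "finite V" and "V \<noteq> {}" and mst: "is_mst V (complete_edges V) w T"
    and h: "{a, b} \<in> T" and g: "{u, v} \<in> complete_edges V"
    and uv: "(u, v) \<notin> conn (T - {{a, b}})"
  shows "w {a, b} \<le> w {u, v}"
proof -
  let ?S = "T - {{a, b}}"
  have st: "spanning_tree V (complete_edges V) T"
    using mst by (simp add: is_mst_def)
  then have "finite T"
    using finite_complete_edges[OF assms(1)] by (auto simp: spanning_tree_def dest: finite_subset)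
  have "{u, v} \<notin> ?S" using uv conn_edge by metis
  then have "sum w (insert {u, v} ?S) = w {u, v} + sum w ?S"
    using \<open>finite T\<close> by simp
  moreover have "sum w T = w {a, b} + sum w ?S"
    using sum.remove[OF \<open>finite T\<close> h] by simp
  moreover have "sum w T \<le> sum w (insert {u, v} ?S)"
    using mst spanning_tree_exchange[OF st assms(2) h g uv] by (simp add: is_mst_def)
  ultimately show ?thesis by simp
qed

lemma mst_eq_kruskal_tree:
  assumes "finite V" and "V \<noteq> {}" and inj: "inj_on w (complete_edges V)"
    and mst: "is_mst V (complete_edges V) w T"
  shows "T = kruskal_tree V w"
proof -
  let ?K = "complete_edges V"
  have T: "T \<subseteq> ?K" "V \<times> V \<subseteq> conn T" "forest T"
    using mst spanning_tree_iff[OF assms(2), of T] by (auto simp: is_mst_def)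
  have "g \<in> kruskal_tree V w" if gT: "g \<in> T" for g
  proof (rule ccontr)
    assume "g \<notin> kruskal_tree V w"
    obtain u v where g: "g = {u, v}"
      using gT T(1) by (blast elim: complete_edgesD)
    let ?L = "{h \<in> ?K. w h < w g}"
    have "(u, v) \<in> conn ?L"
      using \<open>g \<notin> kruskal_tree V w\<close> gT T(1) by (auto simp: kruskal_tree_def g)
    moreover have "(u, v) \<notin> conn (T - {g})"
      using T(3) gT by (simp add: forest_def g)
    ultimately have "\<not> conn ?L \<subseteq> conn (T - {g})" by auto
    then obtain a b where ab: "{a, b} \<in> ?L" "(a, b) \<notin> conn (T - {g})"
      using conn_subset[of ?L "T - {g}"] by blast
    then have "w g \<le> w {a, b}"
      using mst_exchange_le[OF assms(1,2) mst, of u v a b] gT by (simp add: g)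
    then show False using ab(1) by auto
  qed
  moreover have "g \<in> T" if gK: "g \<in> kruskal_tree V w" for g
  proof (rule ccontr)
    assume "g \<notin> T"
    obtain u v where g: "g = {u, v}" "u \<in> V" "v \<in> V" "u \<noteq> v"
      using gK by (auto simp: kruskal_tree_def elim: complete_edgesD)
    \<comment> \<open>A minimal subset of \<open>T\<close> connecting \<open>u\<close> and
      \<open>v\<close> serves as the tree path between them: none of its edges can be spared. One of
      them is heavier than \<open>g\<close> and could be replaced by \<open>g\<close>.\<close>
    let ?A = "{A. A \<subseteq> T \<and> (u, v) \<in> conn A}"
    have "finite ?A"
      by (rule finite_subset[of _ "Pow ?K"]) (use T(1) in \<open>auto simp: finite_complete_edges[OF assms(1)]\<close>)
    moreover have "T \<in> ?A" using T(2) g by auto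
    ultimately obtain A where A: "A \<in> ?A" "\<And>B. B \<in> ?A \<Longrightarrow> B \<subseteq> A \<Longrightarrow> B = A"
      by (metis (no_types, lifting) finite_has_minimal empty_iff)
    have "(u, v) \<notin> conn {h \<in> ?K. w h < w g}"
      using gK by (simp add: kruskal_tree_def g(1))
    then have "\<not> A \<subseteq> {h \<in> ?K. w h < w g}"
      using A(1) conn_mono[of A] by auto
    then obtain h where h: "h \<in> A" "\<not> w h < w g" using A(1) T(1) by blast
    have hT: "h \<in> T" using h(1) A(1) by auto
    then obtain a b where ab: "h = {a, b}" using T(1) by (blast elim: complete_edgesD)
    have "w h \<noteq> w g"
      using inj hT \<open>g \<notin> T\<close> T(1) gK unfolding inj_on_def kruskal_tree_def by blast
    then have less: "w g < w h" using h(2) by simp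
    have "(u, v) \<notin> conn (A - {h})"
      using A(1) A(2)[of "A - {h}"] h(1) by blast
    moreover have "insert {a, b} (A - {h}) = A" using h(1) ab by auto
    then have "(u, v) \<in> conn (insert {a, b} (A - {h}))" using A(1) by simp
    ultimately have "(u, a) \<in> conn (A - {h}) \<and> (b, v) \<in> conn (A - {h}) \<or>
        (u, b) \<in> conn (A - {h}) \<and> (a, v) \<in> conn (A - {h})"
      unfolding conn_insert by blast
    moreover have "conn (A - {h}) \<subseteq> conn (T - {h})" using A(1) by (intro conn_mono) auto
    ultimately have path: "(u, a) \<in> conn (T - {h}) \<and> (b, v) \<in> conn (T - {h}) \<or>
        (u, b) \<in> conn (T - {h}) \<and> (a, v) \<in> conn (T - {h})" by blast
    have "(u, v) \<notin> conn (T - {h})"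
    proof
      assume "(u, v) \<in> conn (T - {h})"
      with path have "(a, b) \<in> conn (T - {h})" by (meson conn_sym conn_trans)
      then show False using T(3) hT unfolding forest_def ab by blast
    qed
    then have "w h \<le> w g"
      using mst_exchange_le[OF assms(1,2) mst, of a b u v] hT g by (simp add: ab)
    then show False using less by simp
  qed
  ultimately show ?thesis by blast
qed

lemma mst_exists:
  assumes "finite V" and "V \<noteq> {}"
  shows "\<exists>T. is_mst V (complete_edges V) w T"
proof -
  let ?A = "{T. spanning_tree V (complete_edges V) T}"
  have "finite ?A"
    by (rule finite_subset[of _ "Pow (complete_edges V)"])
      (auto simp: spanning_tree_def finite_complete_edges[OF assms(1)])
  moreover have "?A \<noteq> {}" using spanning_tree_exists[OF assms] by auto
  ultimately obtain T where "T \<in> ?A" "\<And>T'. T' \<in> ?A \<Longrightarrow> sum w T \<le> sum w T'"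
    using ex_is_arg_min_if_finite[of ?A "sum w"] by (auto simp: is_arg_min_linorder)
  then show ?thesis by (auto simp: is_mst_def)
qed

lemma is_mst_iff:
  assumes "finite V" and "V \<noteq> {}" and "inj_on w (complete_edges V)"
  shows "is_mst V (complete_edges V) w T \<longleftrightarrow> T = kruskal_tree V w"
  using mst_exists[OF assms(1,2), of w] mst_eq_kruskal_tree[OF assms] by metis

text \<open>\<open>E\<close> is the set of all edges examined so far, not only of those that were accepted.\<close>

fun kruskal :: "'v set set \<Rightarrow> 'v set list \<Rightarrow> 'v set set" where
  "kruskal E [] = {}"
| "kruskal E (g # gs) = (if cross E g then {g} else {}) \<union> kruskal (insert g E) gs"

lemma kruskal_subset: "kruskal E xs \<subseteq> set xs"
  by (induction xs arbitrary: E) (auto split: if_splits)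

text \<open>Along increasing weights, the edges examined before \<open>g\<close> are
  \<open>E\<close> and the lighter edges of the list. For the list of all edges and
  \<open>E = {}\<close> this is \<open>kruskal_tree\<close>.\<close>

lemma kruskal_sorted:
  assumes "sorted_wrt (\<lambda>g h. w g < (w h :: real)) xs"
  shows "kruskal E xs = {g \<in> set xs. cross (E \<union> {h \<in> set xs. w h < w g}) g}"
  using assms
proof (induction xs arbitrary: E)
  case Nil
  show ?case by simp
next
  case (Cons x xs)
  have less: "w x < w h" if "h \<in> set xs" for h using Cons.prems that by simp
  have x: "E \<union> {h \<in> set (x # xs). w h < w x} = E" using less by force
  have "E \<union> {h \<in> set (x # xs). w h < w g} = insert x E \<union> {h \<in> set xs. w h < w g}"
    if "g \<in> set xs" for g
    using less[OF that] by auto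
  then have "{g \<in> set xs. cross (E \<union> {h \<in> set (x # xs). w h < w g}) g} = kruskal (insert x E) xs"
    using Cons by auto
  moreover have "{g \<in> set (x # xs). cross (E \<union> {h \<in> set (x # xs). w h < w g}) g} =
     {g \<in> {x}. cross (E \<union> {h \<in> set (x # xs). w h < w g}) g} \<union>
     {g \<in> set xs. cross (E \<union> {h \<in> set (x # xs). w h < w g}) g}" by auto
  moreover have "{g \<in> {x}. cross (E \<union> {h \<in> set (x # xs). w h < w g}) g} = (if cross E x then {x} else {})"
    using x by auto
  ultimately show ?case by simp
qed

section \<open>Adjacent pairs along a uniformly random edge order\<close>

definition component :: "'v set \<Rightarrow> 'v set set \<Rightarrow> 'v \<Rightarrow> 'v set" where
  "component V E x = {y \<in> V. (x, y) \<in> conn E}"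

text \<open>The vertices of one component contribute 1 in total. Counting by vertices keeps all
  later sums over \<open>V\<close> and supplies the reciprocals that Cauchy--Schwarz needs.\<close>

definition num_components :: "'v set \<Rightarrow> 'v set set \<Rightarrow> real" where
  "num_components V E = (\<Sum>x\<in>V. 1 / real (card (component V E x)))"

definition vertex_degree :: "'v set set \<Rightarrow> 'v \<Rightarrow> nat" where
  "vertex_degree F x = card {g \<in> F. x \<in> g}"

text \<open>The pairs are ordered, so two adjacent edges count twice.\<close>

definition adjacent_pairs :: "'v set set \<Rightarrow> ('v set \<times> 'v set) set" where
  "adjacent_pairs F = {(g, h). g \<in> F \<and> h \<in> F \<and> g \<noteq> h \<and> g \<inter> h \<noteq> {}}"

section \<open>Components, crossing edges and degrees\<close>

lemma component_eqI: "(x, y) \<in> conn E \<Longrightarrow> component V E x = component V E y"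
  unfolding component_def by (auto intro: conn_trans dest: conn_sym)

lemma component_eq_if_mem: "x \<in> component V E u \<Longrightarrow> component V E x = component V E u"
  by (rule component_eqI[symmetric]) (simp add: component_def)

lemma finite_component: "finite V \<Longrightarrow> finite (component V E x)"
  by (simp add: component_def)

lemma card_component_pos: "finite V \<Longrightarrow> x \<in> V \<Longrightarrow> 0 < card (component V E x)"
  by (auto simp: card_gt_0_iff component_def)

lemma component_insert:
  assumes "u \<in> V" and "v \<in> V" and "x \<in> V"
  shows "component V (insert {u, v} E) x =
    (if x \<in> component V E u \<union> component V E v then component V E u \<union> component V E v
     else component V E x)"
proof -
  have "(x, u) \<in> conn E \<longleftrightarrow> (u, x) \<in> conn E" "(x, v) \<in> conn E \<longleftrightarrow> (v, x) \<in> conn E"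
    by (auto dest: conn_sym)
  then show ?thesis
    using assms by (auto simp: component_def conn_insert) (meson conn_sym conn_trans)+
qed

text \<open>Lying in the same component is symmetric, so exchanging the two summations only swaps
  the names.\<close>

lemma sum_component_swap:
  assumes "finite V"
  shows "(\<Sum>x\<in>V. \<Sum>y\<in>component V E x. h x y) = (\<Sum>x\<in>V. \<Sum>y\<in>component V E x. h y x)"
proof -
  have "(x, y) \<in> conn E \<longleftrightarrow> (y, x) \<in> conn E" for x y by (auto dest: conn_sym)
  then show ?thesis
    unfolding component_def by (subst sum.swap_restrict[OF assms assms]) simp
qed

text \<open>Every edge arises from exactly two ordered pairs of distinct vertices.\<close>

lemma sum_complete_edges:
  fixes \<phi> :: "'v set \<Rightarrow> real"
  assumes "finite V"
  shows "2 * (\<Sum>g\<in>complete_edges V. \<phi> g) = (\<Sum>(x, y)\<in>{(x, y). x \<in> V \<and> y \<in> V \<and> x \<noteq> y}. \<phi> {x, y})"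
proof -
  let ?S = "{(x, y). x \<in> V \<and> y \<in> V \<and> x \<noteq> y}"
  let ?p = "\<lambda>(x, y). {x, y}"
  have fin: "finite ?S" by (rule finite_subset[of _ "V \<times> V"]) (use assms in auto)
  have "(\<Sum>z\<in>?S. \<phi> (?p z)) = (\<Sum>g\<in>complete_edges V. \<Sum>z\<in>{z \<in> ?S. ?p z = g}. \<phi> (?p z))"
    by (rule sum.group[symmetric, OF fin finite_complete_edges[OF assms]]) auto
  also have "\<dots> = (\<Sum>g\<in>complete_edges V. 2 * \<phi> g)"
  proof (rule sum.cong[OF refl])
    fix g assume "g \<in> complete_edges V"
    then obtain u v where g: "g = {u, v}" "u \<in> V" "v \<in> V" "u \<noteq> v" by (rule complete_edgesD)
    then have "{z \<in> ?S. ?p z = g} = {(u, v), (v, u)}" by (auto simp: doubleton_eq_iff)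
    then show "(\<Sum>z\<in>{z \<in> ?S. ?p z = g}. \<phi> (?p z)) = 2 * \<phi> g"
      using g by (simp add: insert_commute)
  qed
  finally show ?thesis by (simp add: sum_distrib_left case_prod_unfold)
qed

lemma sum_cross:
  fixes \<phi> :: "'v set \<Rightarrow> real"
  assumes "finite V"
  shows "2 * (\<Sum>g | g \<in> complete_edges V \<and> cross E g. \<phi> g) =
    (\<Sum>x\<in>V. \<Sum>y\<in>V - component V E x. \<phi> {x, y})"
proof -
  let ?S = "{(x, y). x \<in> V \<and> y \<in> V \<and> x \<noteq> y}"
  have fin: "finite ?S" by (rule finite_subset[of _ "V \<times> V"]) (use assms in auto)
  have "(\<Sum>g | g \<in> complete_edges V \<and> cross E g. \<phi> g) =
      (\<Sum>g\<in>complete_edges V. if cross E g then \<phi> g else 0)"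
    by (simp add: sum.inter_filter[OF finite_complete_edges[OF assms]])
  then have "2 * (\<Sum>g | g \<in> complete_edges V \<and> cross E g. \<phi> g) =
      (\<Sum>z\<in>?S. if cross E {fst z, snd z} then \<phi> {fst z, snd z} else 0)"
    by (simp only: sum_complete_edges[OF assms] case_prod_unfold)
  also have "\<dots> = (\<Sum>z\<in>(SIGMA x:V. V - component V E x). \<phi> {fst z, snd z})"
    using assms fin by (intro sum.mono_neutral_cong_right) (auto simp: component_def)
  also have "\<dots> = (\<Sum>x\<in>V. \<Sum>y\<in>V - component V E x. \<phi> {x, y})"
    using assms by (subst sum.Sigma) (auto simp: case_prod_unfold)
  finally show ?thesis .
qed

lemma vertex_degree_insert:
  assumes "finite F" and "g \<notin> F"
  shows "vertex_degree (insert g F) x = vertex_degree F x + (if x \<in> g then 1 else 0)"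
proof (cases "x \<in> g")
  case True
  then have "{h \<in> insert g F. x \<in> h} = insert g {h \<in> F. x \<in> h}" by auto
  then show ?thesis using assms True by (simp add: vertex_degree_def)
next
  case False
  then have "{h \<in> insert g F. x \<in> h} = {h \<in> F. x \<in> h}" by auto
  then show ?thesis using False by (simp add: vertex_degree_def)
qed

lemma finite_adjacent_pairs: "finite F \<Longrightarrow> finite (adjacent_pairs F)"
  by (rule finite_subset[of _ "F \<times> F"]) (auto simp: adjacent_pairs_def)

text \<open>The new pairs consist of \<open>g\<close> and a neighbouring edge, in both orders. An
  edge of \<open>F\<close> containing both ends of \<open>g\<close> would be \<open>g\<close>, so
  the degrees count each neighbouring edge once.\<close>

lemma card_adjacent_pairs_insert:
  assumes "finite F" and "F \<subseteq> complete_edges V" and "g \<in> complete_edges V" and "g \<notin> F"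
  shows "card (adjacent_pairs (insert g F)) = card (adjacent_pairs F) + 2 * (\<Sum>z\<in>g. vertex_degree F z)"
proof -
  obtain u v where g: "g = {u, v}" "u \<noteq> v" using assms(3) by (blast elim: complete_edgesD)
  let ?N = "{h \<in> F. h \<inter> g \<noteq> {}}"
  have disj: "{h \<in> F. u \<in> h} \<inter> {h \<in> F. v \<in> h} = {}"
  proof -
    have "h = g" if "h \<in> F" "u \<in> h" "v \<in> h" for h
      using that assms(2) g by (auto elim: complete_edgesD)
    then show ?thesis using assms(4) by blast
  qed
  have "?N = {h \<in> F. u \<in> h} \<union> {h \<in> F. v \<in> h}" using g by auto
  then have N: "card ?N = (\<Sum>z\<in>g. vertex_degree F z)"
    using assms(1) g disj by (simp add: vertex_degree_def card_Un_disjoint)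
  have "adjacent_pairs (insert g F) = adjacent_pairs F \<union> ({g} \<times> ?N \<union> ?N \<times> {g})"
    using assms(4) by (auto simp: adjacent_pairs_def)
  moreover have "adjacent_pairs F \<inter> ({g} \<times> ?N \<union> ?N \<times> {g}) = {}"
    using assms(4) by (auto simp: adjacent_pairs_def)
  moreover have "({g} \<times> ?N) \<inter> (?N \<times> {g}) = {}" using assms(4) by auto
  ultimately show ?thesis
    using assms(1) finite_adjacent_pairs[OF assms(1)]
    by (simp add: card_Un_disjoint card_cartesian_product N)
qed

section \<open>Invariants of the accepted forest\<close>

text \<open>
  \<open>E\<close> are the examined and \<open>F\<close> the accepted edges; the last two conjuncts say that \<open>F\<close> is a spanning
  tree of every component, in the only form in which this is needed.
\<close>

definition kruskal_state :: "'v set \<Rightarrow> 'v set set \<Rightarrow> 'v set set \<Rightarrow> bool" where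
  "kruskal_state V E F \<longleftrightarrow> E \<subseteq> complete_edges V \<and> F \<subseteq> E \<and>
     (\<forall>x\<in>V. (\<Sum>y\<in>component V E x. real (vertex_degree F y)) = 2 * real (card (component V E x)) - 2) \<and>
     num_components V E + real (card F) = real (card V)"

lemma kruskal_state_empty:
  shows "kruskal_state V {} {}"
proof -
  have "component V {} x = {x}" if "x \<in> V" for x
    using that by (auto simp: component_def conn_def)
  then show ?thesis by (simp add: kruskal_state_def num_components_def vertex_degree_def)
qed

text \<open>On the merged component the reciprocals summed to 2 before and sum to 1 afterwards;
  elsewhere nothing changes.\<close>

lemma num_components_insert:
  assumes fin: "finite V" and "u \<in> V" and "v \<in> V" and "(u, v) \<notin> conn E"
  shows "num_components V (insert {u, v} E) = num_components V E - 1"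
proof -
  let ?A = "component V E u" and ?B = "component V E v"
  have disj: "?A \<inter> ?B = {}"
    using assms(4) by (auto simp: component_def dest: conn_sym intro: conn_trans)
  have sub: "?A \<union> ?B \<subseteq> V" by (auto simp: component_def)
  have finA: "finite ?A" "finite ?B" using fin by (simp_all add: finite_component)
  have cA: "card ?A > 0" "card ?B > 0" using assms by (simp_all add: card_component_pos)
  have split: "(\<Sum>x\<in>V. h x) = (\<Sum>x\<in>V - (?A \<union> ?B). h x) + (\<Sum>x\<in>?A \<union> ?B. h x)" for h :: "_ \<Rightarrow> real"
    by (rule sum.subset_diff[OF sub fin])
  have "(\<Sum>x\<in>?A \<union> ?B. 1 / real (card (component V (insert {u, v} E) x))) =
      (\<Sum>x\<in>?A \<union> ?B. 1 / real (card (?A \<union> ?B)))"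
    using sub assms by (intro sum.cong) (auto simp: component_insert)
  also have "\<dots> = 1" using cA finA by (simp add: card_Un_disjoint[OF finA disj])
  finally have 1: "(\<Sum>x\<in>?A \<union> ?B. 1 / real (card (component V (insert {u, v} E) x))) = 1" .
  have "(\<Sum>x\<in>?A. 1 / real (card (component V E x))) = (\<Sum>x\<in>?A. 1 / real (card ?A))"
    by (intro sum.cong) (simp_all add: component_eq_if_mem)
  then have 2: "(\<Sum>x\<in>?A. 1 / real (card (component V E x))) = 1" using cA by simp
  have "(\<Sum>x\<in>?B. 1 / real (card (component V E x))) = (\<Sum>x\<in>?B. 1 / real (card ?B))"
    by (intro sum.cong) (simp_all add: component_eq_if_mem)
  then have 3: "(\<Sum>x\<in>?B. 1 / real (card (component V E x))) = 1" using cA by simp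
  have 4: "(\<Sum>x\<in>?A \<union> ?B. 1 / real (card (component V E x))) = 2"
    using 2 3 by (simp add: sum.union_disjoint[OF finA disj])
  have "(\<Sum>x\<in>V - (?A \<union> ?B). 1 / real (card (component V (insert {u, v} E) x))) =
      (\<Sum>x\<in>V - (?A \<union> ?B). 1 / real (card (component V E x)))"
    using assms by (intro sum.cong) (simp_all add: component_insert)
  then show ?thesis using 1 4 split unfolding num_components_def by (simp add: split)
qed

text \<open>A rejected edge leaves all components alone. An accepted edge merges components of sizes
  a and b and raises their total degree by 2, and (2a - 2) + (2b - 2) + 2 = 2(a + b) - 2.\<close>

lemma kruskal_state_insert:
  assumes fin: "finite V" and st: "kruskal_state V E F" and g: "g \<in> complete_edges V"
  shows "kruskal_state V (insert g E) (F \<union> (if cross E g then {g} else {}))"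
proof -
  obtain u v where uv: "g = {u, v}" "u \<in> V" "v \<in> V" "u \<noteq> v" using g by (rule complete_edgesD)
  have F: "E \<subseteq> complete_edges V" "F \<subseteq> E"
    "\<And>x. x \<in> V \<Longrightarrow> (\<Sum>y\<in>component V E x. real (vertex_degree F y)) = 2 * real (card (component V E x)) - 2"
    "num_components V E + real (card F) = real (card V)"
    using st by (auto simp: kruskal_state_def)
  have finF: "finite F"
    using F finite_complete_edges[OF fin] by (meson finite_subset)
  show ?thesis
  proof (cases "cross E g")
    case False
    then have "conn (insert g E) = conn E" by (simp add: uv conn_insert_redundant)
    then have "component V (insert g E) = component V E" by (simp add: component_def fun_eq_iff)
    then show ?thesis
      using st g False by (auto simp: kruskal_state_def num_components_def)
  next
    case True
    then have nc: "(u, v) \<notin> conn E" by (simp add: uv)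
    have gF: "g \<notin> F" using not_cross_if_mem[OF g] True F(2) by auto
    let ?A = "component V E u" and ?B = "component V E v"
    have disj: "?A \<inter> ?B = {}"
      using nc by (auto simp: component_def dest: conn_sym intro: conn_trans)
    have finA: "finite ?A" "finite ?B" using fin by (simp_all add: finite_component)
    have mem: "u \<in> ?A" "v \<in> ?B" using uv by (auto simp: component_def)
    have deg: "(\<Sum>y\<in>S. real (vertex_degree (insert g F) y)) = (\<Sum>y\<in>S. real (vertex_degree F y)) + real (card (S \<inter> g))"
      if "finite S" for S
    proof -
      have "(\<Sum>y\<in>S. real (if y \<in> g then 1 else 0)) = real (card (S \<inter> g))"
        using that by (simp add: sum.If_cases Int_def flip: of_nat_sum)
      then show ?thesis using that by (simp add: vertex_degree_insert[OF finF gF] sum.distrib)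
    qed
    have "(\<Sum>y\<in>component V (insert g E) x. real (vertex_degree (insert g F) y)) =
        2 * real (card (component V (insert g E) x)) - 2" if x: "x \<in> V" for x
    proof (cases "x \<in> ?A \<union> ?B")
      case True
      then have c: "component V (insert g E) x = ?A \<union> ?B" by (simp add: uv x component_insert)
      have "(?A \<union> ?B) \<inter> g = g" using mem uv(1) by auto
      moreover have "card g = 2" using uv by simp
      ultimately show ?thesis
        unfolding c using finA F(3)[OF uv(2)] F(3)[OF uv(3)] deg[of "?A \<union> ?B"]
        by (simp add: sum.union_disjoint[OF finA disj] card_Un_disjoint[OF finA disj])
    next
      case False
      then have c: "component V (insert g E) x = component V E x" by (simp add: uv x component_insert)
      have "component V E x \<inter> g = {}"
        using False x uv(1) by (auto simp: component_def dest: conn_sym)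
      then show ?thesis unfolding c using fin F(3)[OF x] by (simp add: deg finite_component)
    qed
    moreover have "num_components V (insert g E) = num_components V E - 1"
      unfolding uv(1) by (rule num_components_insert[OF fin uv(2,3) nc])
    ultimately show ?thesis
      using F g finF gF True by (auto simp: kruskal_state_def)
  qed
qed

text \<open>Only the total degree of each component is known. So the summand of a vertex is spread
  evenly over its component, and swapping the double sum makes these totals appear.\<close>

lemma kruskal_state_sums:
  assumes fin: "finite V" and st: "kruskal_state V E F"
  shows "(\<Sum>x\<in>V. real (vertex_degree F x)) = 2 * real (card V) - 2 * num_components V E"
    and "(\<Sum>x\<in>V. real (card (component V E x)) * real (vertex_degree F x)) =
      2 * (\<Sum>x\<in>V. real (card (component V E x))) - 2 * real (card V)"
proof -
  let ?c = "\<lambda>x. real (card (component V E x))" and ?d = "\<lambda>x. real (vertex_degree F x)"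
  have deg: "(\<Sum>y\<in>component V E x. ?d y) = 2 * ?c x - 2" if "x \<in> V" for x
    using st that by (simp add: kruskal_state_def)
  have pos: "?c x > 0" if "x \<in> V" for x using card_component_pos[OF fin that] by simp
  have "(\<Sum>x\<in>V. ?d x) = (\<Sum>x\<in>V. \<Sum>y\<in>component V E x. ?d x / ?c x)"
    using pos by (intro sum.cong refl) (simp add: field_simps less_imp_neq[symmetric])
  also have "\<dots> = (\<Sum>x\<in>V. \<Sum>y\<in>component V E x. ?d y / ?c y)"
    by (rule sum_component_swap[OF fin])
  also have "\<dots> = (\<Sum>x\<in>V. \<Sum>y\<in>component V E x. ?d y / ?c x)"
    by (intro sum.cong refl) (simp add: component_eq_if_mem)
  also have "\<dots> = (\<Sum>x\<in>V. 2 - 2 * (1 / ?c x))"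
    using pos by (intro sum.cong refl)
      (simp add: sum_divide_distrib[symmetric] deg diff_divide_distrib less_imp_neq[symmetric])
  also have "\<dots> = 2 * real (card V) - 2 * num_components V E"
    by (simp add: sum_subtractf num_components_def sum_distrib_left)
  finally show "(\<Sum>x\<in>V. ?d x) = 2 * real (card V) - 2 * num_components V E" .
  have "(\<Sum>x\<in>V. ?c x * ?d x) = (\<Sum>x\<in>V. \<Sum>y\<in>component V E x. ?d x)"
    by simp
  also have "\<dots> = (\<Sum>x\<in>V. \<Sum>y\<in>component V E x. ?d y)"
    by (rule sum_component_swap[OF fin])
  also have "\<dots> = 2 * (\<Sum>x\<in>V. ?c x) - 2 * real (card V)"
    by (simp add: deg sum_subtractf sum_distrib_left)
  finally show "(\<Sum>x\<in>V. ?c x * ?d x) = 2 * (\<Sum>x\<in>V. ?c x) - 2 * real (card V)" .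
qed

text \<open>Both sides count ordered pairs of vertices in different components; the last sum is the
  sum of the squared component sizes.\<close>

lemma card_cross:
  assumes fin: "finite V"
  shows "2 * real (card {g \<in> complete_edges V. cross E g}) =
    (real (card V))\<^sup>2 - (\<Sum>x\<in>V. real (card (component V E x)))"
proof -
  have sub: "component V E x \<subseteq> V" for x by (auto simp: component_def)
  have "2 * real (card {g \<in> complete_edges V. cross E g}) =
      (\<Sum>x\<in>V. real (card (V - component V E x)))"
    using sum_cross[OF fin, of "\<lambda>_. 1" E] by simp
  also have "\<dots> = (\<Sum>x\<in>V. real (card V) - real (card (component V E x)))"
    using sub fin by (intro sum.cong refl)
      (simp add: card_Diff_subset finite_component of_nat_diff card_mono)
  finally show ?thesis by (simp add: sum_subtractf power2_eq_square)
qed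

text \<open>The number of new adjacent pairs, summed over all candidates for the next accepted edge.
  It depends on the component sizes only, although the degrees inside the components are
  unknown.\<close>

lemma sum_vertex_degree_cross:
  assumes fin: "finite V" and st: "kruskal_state V E F"
  shows "(\<Sum>g | g \<in> complete_edges V \<and> cross E g. 2 * (\<Sum>z\<in>g. real (vertex_degree F z))) =
    8 * real (card {g \<in> complete_edges V. cross E g}) -
      4 * real (card V) * (num_components V E - 1)"
proof -
  let ?c = "\<lambda>x. real (card (component V E x))" and ?d = "\<lambda>x. real (vertex_degree F x)"
  let ?n = "real (card V)"
  have sub: "component V E x \<subseteq> V" for x by (auto simp: component_def)
  have deg: "(\<Sum>y\<in>component V E x. ?d y) = 2 * ?c x - 2" if "x \<in> V" for x
    using st that by (simp add: kruskal_state_def)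
  have "2 * (\<Sum>g | g \<in> complete_edges V \<and> cross E g. 2 * (\<Sum>z\<in>g. ?d z)) =
      (\<Sum>x\<in>V. \<Sum>y\<in>V - component V E x. 2 * (\<Sum>z\<in>{x, y}. ?d z))"
    by (rule sum_cross[OF fin])
  also have "\<dots> = (\<Sum>x\<in>V. 2 * ((?n - ?c x) * ?d x + ((\<Sum>y\<in>V. ?d y) - (2 * ?c x - 2))))"
  proof (rule sum.cong[OF refl])
    fix x assume x: "x \<in> V"
    have "x \<in> component V E x" using x by (simp add: component_def)
    then have "(\<Sum>y\<in>V - component V E x. 2 * (\<Sum>z\<in>{x, y}. ?d z)) =
        (\<Sum>y\<in>V - component V E x. 2 * ?d x + 2 * ?d y)"
      by (intro sum.cong refl) (auto simp: sum.insert_if)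
    also have "\<dots> = 2 * (real (card (V - component V E x)) * ?d x + (\<Sum>y\<in>V - component V E x. ?d y))"
      by (simp add: sum.distrib sum_distrib_left)
    also have "real (card (V - component V E x)) = ?n - ?c x"
      using sub[of x] fin by (simp add: card_Diff_subset finite_component of_nat_diff card_mono)
    also have "(\<Sum>y\<in>V - component V E x. ?d y) = (\<Sum>y\<in>V. ?d y) - (2 * ?c x - 2)"
      using sub[of x] fin by (simp add: sum_diff deg[OF x])
    finally show "(\<Sum>y\<in>V - component V E x. 2 * (\<Sum>z\<in>{x, y}. ?d z)) =
      2 * ((?n - ?c x) * ?d x + ((\<Sum>y\<in>V. ?d y) - (2 * ?c x - 2)))" .
  qed
  also have "\<dots> = 2 * (?n * (\<Sum>x\<in>V. ?d x) - (\<Sum>x\<in>V. ?c x * ?d x) + ?n * (\<Sum>x\<in>V. ?d x)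
      - (2 * (\<Sum>x\<in>V. ?c x) - 2 * ?n))"
    by (simp add: sum.distrib sum_subtractf left_diff_distrib flip: sum_distrib_left)
  also have "\<dots> = 8 * (?n\<^sup>2 - (\<Sum>x\<in>V. ?c x)) - 8 * ?n * (num_components V E - 1)"
    unfolding kruskal_state_sums[OF fin st] by (simp add: algebra_simps power2_eq_square)
  finally show ?thesis using card_cross[OF fin, of E] by simp
qed

section \<open>Component sizes and the bound on the growth\<close>

lemma sum_card_component_ge:
  assumes fin: "finite V" and "V \<noteq> {}"
  shows "(real (card V))\<^sup>2 \<le> num_components V E * (\<Sum>x\<in>V. real (card (component V E x)))"
    and "3 * real (card V) - 2 * num_components V E \<le> (\<Sum>x\<in>V. real (card (component V E x)))"
    and "0 < num_components V E"
proof -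
  let ?c = "\<lambda>x. real (card (component V E x))"
  let ?n = "real (card V)" and ?m = "num_components V E" and ?C = "\<Sum>x\<in>V. ?c x"
  have pos: "?c x \<ge> 1" if "x \<in> V" for x using card_component_pos[OF fin that, of E] by simp
  show m: "0 < ?m"
    unfolding num_components_def using fin \<open>V \<noteq> {}\<close> pos by (intro sum_pos) force+
  \<comment> \<open>Cauchy--Schwarz by completing the square. Below, \<open>r\<close> becomes
    \<open>?n / ?m\<close>, the mean component size, which makes the summed bound largest.\<close>
  have "2 * r - r\<^sup>2 * (1 / ?c x) \<le> ?c x" if "x \<in> V" for x and r :: real
  proof -
    have "0 \<le> (?c x - r)\<^sup>2 / ?c x" using pos[OF that] by simp
    also have "\<dots> = ?c x - 2 * r + r\<^sup>2 * (1 / ?c x)"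
      using pos[OF that] by (simp add: power2_eq_square field_simps)
    finally show ?thesis by simp
  qed
  then have "(\<Sum>x\<in>V. 2 * (?n / ?m) - (?n / ?m)\<^sup>2 * (1 / ?c x)) \<le> ?C" by (rule sum_mono)
  also have "(\<Sum>x\<in>V. 2 * (?n / ?m) - (?n / ?m)\<^sup>2 * (1 / ?c x)) = ?n * (2 * (?n / ?m)) - (?n / ?m)\<^sup>2 * ?m"
    unfolding sum_subtractf sum_distrib_left[symmetric] num_components_def by simp
  also have "\<dots> = ?n\<^sup>2 / ?m" using m by (simp add: power2_eq_square field_simps)
  finally show "?n\<^sup>2 \<le> ?m * ?C" using m by (simp add: field_simps)
  \<comment> \<open>This is (c - 1)(c - 2) \<ge> 0 divided by c, for an integer c. Equality holds
    for sizes 1 and 2, hence for all components once a single edge has been accepted.\<close>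
  have "3 - 2 * (1 / ?c x) \<le> ?c x" if "x \<in> V" for x
  proof (cases "card (component V E x) = 1")
    case False
    then have "?c x \<ge> 2" using card_component_pos[OF fin that, of E] by simp
    then have "0 \<le> (?c x - 1) * (?c x - 2) / ?c x" by simp
    also have "\<dots> = ?c x - 3 + 2 * (1 / ?c x)" using pos[OF that] by (simp add: field_simps)
    finally show ?thesis by simp
  qed simp
  then have "(\<Sum>x\<in>V. 3 - 2 * (1 / ?c x)) \<le> ?C" by (rule sum_mono)
  moreover have "(\<Sum>x\<in>V. 3 - 2 * (1 / ?c x)) = 3 * ?n - 2 * ?m"
    unfolding sum_subtractf sum_distrib_left[symmetric] num_components_def by simp
  ultimately show "3 * ?n - 2 * ?m \<le> ?C" by simp
qed

text \<open>
  With \<open>m = n - k\<close> components left, this is the sum of \<open>8 - 8 j / n\<close> over \<open>2 \<le> j \<le> m\<close>, where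
  \<open>8 - 8 j / n\<close> bounds the mean growth of \<open>card (adjacent_pairs F)\<close> when \<open>j\<close> components become \<open>j - 1\<close>.
  The last term is what the step with \<open>j = n - 1\<close> gains because its component sizes cannot all be
  equal; the strict inequality of the theorem comes from it.
\<close>

definition pair_bound :: "nat \<Rightarrow> nat \<Rightarrow> real" where
  "pair_bound n k = (let m = real n - real k in
     8 * (m - 1) - 4 / real n * (m * (m + 1) - 2) - (if k \<le> 1 then 8 / (real n * (real n + 1)) else 0))"

text \<open>The correction is present at 0 and 1 and absent from 2 on, so it survives only in the
  difference at \<open>k = 1\<close>.\<close>

lemma pair_bound_diff:
  assumes "n > 0"
  shows "pair_bound n k - pair_bound n (Suc k) =
    8 - 8 * (real n - real k) / real n - (if k = 1 then 8 / (real n * (real n + 1)) else 0)"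
  using assms by (auto simp: pair_bound_def Let_def field_simps)

text \<open>With \<open>a\<close> crossing edges the total growth is
  \<open>8 * a - 4 * N * (m - 1)\<close>. Cauchy--Schwarz, as
  \<open>2 * a * m \<le> N * N * (m - 1)\<close>, settles every step except the one after a single
  accepted edge.\<close>

lemma sum_cross_le_pair_bound:
  assumes fin: "finite V" and n: "card V \<ge> 3" and st: "kruskal_state V E F"
  shows "(\<Sum>g | g \<in> complete_edges V \<and> cross E g. 2 * (\<Sum>z\<in>g. real (vertex_degree F z))) \<le>
    real (card {g \<in> complete_edges V. cross E g}) *
      (pair_bound (card V) (card F) - pair_bound (card V) (Suc (card F)))"
proof -
  define a where "a = real (card {g \<in> complete_edges V. cross E g})"
  define C where "C = (\<Sum>x\<in>V. real (card (component V E x)))"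
  define N where "N = real (card V)"
  define m where "m = num_components V E"
  have "V \<noteq> {}" using n by auto
  have N: "N \<ge> 3" using n by (simp add: N_def)
  have k: "N - real (card F) = m" using st by (simp add: kruskal_state_def N_def m_def)
  have a: "2 * a = N\<^sup>2 - C" using card_cross[OF fin] by (simp add: a_def N_def C_def)
  have ge: "N\<^sup>2 \<le> m * C" "3 * N - 2 * m \<le> C" "m > 0"
    using sum_card_component_ge[OF fin \<open>V \<noteq> {}\<close>, of E] by (simp_all add: N_def m_def C_def)
  have "8 * a - 4 * N * (m - 1) \<le>
      a * (8 - 8 * m / N - (if card F = 1 then 8 / (N * (N + 1)) else 0))"
  proof (cases "card F = 1")
    case False
    have "2 * a * m = (N\<^sup>2 - C) * m" by (simp only: a)
    then have "2 * a * m \<le> N * N * (m - 1)"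
      using ge(1) by (simp add: algebra_simps power2_eq_square)
    then have "2 * a * m / N \<le> N * (m - 1)" using N by (simp add: field_simps)
    moreover have "a * (8 - 8 * m / N) = 8 * a - 4 * (2 * a * m / N)"
      by (simp add: right_diff_distrib)
    ultimately show ?thesis using False by simp
  next
    case True
    then have m: "m = N - 1" using k by simp
    \<comment> \<open>Here Cauchy--Schwarz is not sharp, while the other estimate gives
      \<open>C \<ge> N + 2\<close>. The correction \<open>8 / (N * (N + 1))\<close> is exactly the
      gain that this allows.\<close>
    have "2 * a \<le> (N - 2) * (N + 1)" using ge(2) m a by (simp add: algebra_simps power2_eq_square)
    then have "2 * a * N \<le> (N - 2) * (N + 1) * N" using N by (intro mult_right_mono) auto
    then have "2 * a * N / (N + 1) \<le> N * (N - 2)" using N by (simp add: pos_divide_le_eq mult_ac)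
    moreover have "8 * m / N + 8 / (N * (N + 1)) = (8 * (m * (N + 1)) + 8) / (N * (N + 1))"
      using N by (simp add: add_divide_distrib)
    moreover have "\<dots> = 8 * N * N / (N * (N + 1))" by (simp add: m algebra_simps)
    moreover have "\<dots> = 8 * N / (N + 1)" using N by simp
    ultimately have "2 * a * N / (N + 1) \<le> N * (N - 2)" "8 * m / N + 8 / (N * (N + 1)) = 8 * N / (N + 1)"
      by simp_all
    moreover from this have "8 - 8 * m / N - 8 / (N * (N + 1)) = 8 - 8 * N / (N + 1)" by linarith
    then have "a * (8 - 8 * m / N - 8 / (N * (N + 1))) = 8 * a - 4 * (2 * a * N / (N + 1))"
      by (simp only: right_diff_distrib) simp
    ultimately show ?thesis using True m by simp
  qed
  then show ?thesis
    using n k unfolding sum_vertex_degree_cross[OF fin st] a_def N_def m_def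
    by (simp add: pair_bound_diff)
qed

section \<open>Averaging over the order of the remaining edges\<close>

lemma sum_permutations_of_set_rec:
  assumes "finite A" and "A \<noteq> {}"
  shows "(\<Sum>xs\<in>permutations_of_set A. h xs) = (\<Sum>x\<in>A. \<Sum>xs\<in>permutations_of_set (A - {x}). h (x # xs))"
proof -
  have "(\<Sum>xs\<in>permutations_of_set A. h xs) =
      (\<Sum>x\<in>A. \<Sum>xs\<in>(#) x ` permutations_of_set (A - {x}). h xs)"
    unfolding permutations_of_set_nonempty[OF assms(2)]
    using assms(1) by (intro sum.UNION_disjoint) auto
  also have "\<dots> = (\<Sum>x\<in>A. \<Sum>xs\<in>permutations_of_set (A - {x}). h (x # xs))"
    by (intro sum.cong refl sum.reindex[unfolded comp_def]) (simp add: inj_on_def)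
  finally show ?thesis .
qed

lemma kruskal_state_kruskal:
  assumes "finite V" and "kruskal_state V E F" and "set xs \<subseteq> complete_edges V"
  shows "kruskal_state V (E \<union> set xs) (F \<union> kruskal E xs)"
  using assms(2,3)
proof (induction xs arbitrary: E F)
  case (Cons g xs)
  have "kruskal_state V (insert g E \<union> set xs)
      ((F \<union> (if cross E g then {g} else {})) \<union> kruskal (insert g E) xs)"
    using Cons by (intro Cons.IH kruskal_state_insert[OF assms(1)]) auto
  then show ?case by (simp add: Un_assoc)
qed simp

lemma num_components_complete:
  assumes "finite V" and "V \<noteq> {}"
  shows "num_components V (complete_edges V) = 1"
proof -
  have "(x, y) \<in> conn (complete_edges V)" if "x \<in> V" "y \<in> V" for x y
    using that by (cases "x = y") (auto intro: conn_edge)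
  then have "component V (complete_edges V) x = V" if "x \<in> V" for x
    using that by (auto simp: component_def)
  then show ?thesis using assms by (simp add: num_components_def)
qed

text \<open>The potential \<open>card (adjacent_pairs F) + pair_bound (card V) (card F)\<close> does
  not grow on average when a random unexamined edge is examined; the induction is on the number of
  such edges. Sums over orders stand for expectations, whence the factorial.\<close>

lemma sum_adjacent_pairs_kruskal_le:
  assumes fin: "finite V" and n: "card V \<ge> 3" and st: "kruskal_state V E F"
  shows "(\<Sum>xs\<in>permutations_of_set (complete_edges V - E). real (card (adjacent_pairs (F \<union> kruskal E xs))))
    \<le> fact (card (complete_edges V - E)) * (real (card (adjacent_pairs F)) + pair_bound (card V) (card F))"
  using st
proof (induction "card (complete_edges V - E)" arbitrary: E F)
  case 0
  let ?K = "complete_edges V"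
  have finK: "finite ?K" using fin by (rule finite_complete_edges)
  have "V \<noteq> {}" using n by auto
  have E: "E = ?K" using 0 finK by (auto simp: kruskal_state_def)
  then have "real (card V) - real (card F) = 1"
    using 0(2) num_components_complete[OF fin \<open>V \<noteq> {}\<close>] by (simp add: kruskal_state_def)
  \<comment> \<open>One component is left. The correction is absent, as
    \<open>card F = card V - 1\<close> is at least 2.\<close>
  then have "pair_bound (card V) (card F) = 0"
    using n by (simp add: pair_bound_def)
  then show ?case by (simp add: E)
next
  case (Suc r)
  let ?K = "complete_edges V" and ?J = "\<lambda>F. real (card (adjacent_pairs F))" and ?b = "pair_bound (card V)"
  let ?R = "?K - E"
  have finK: "finite ?K" using fin by (rule finite_complete_edges)
  have finR: "finite ?R" using finK by simp
  have R: "?R \<noteq> {}" "card ?R = Suc r" using Suc.hyps(2) by (metis card.empty nat.distinct(1), simp)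
  have F: "F \<subseteq> E" "E \<subseteq> ?K" using Suc.prems by (auto simp: kruskal_state_def)
  have finF: "finite F" using F finK by (meson finite_subset)
  \<comment> \<open>The change of the potential when \<open>g\<close> is examined; a rejected edge
    changes neither \<open>F\<close> nor the potential.\<close>
  let ?\<Delta> = "\<lambda>g. if cross E g then 2 * (\<Sum>z\<in>g. real (vertex_degree F z)) - (?b (card F) - ?b (Suc (card F))) else 0"
  have step: "(\<Sum>xs\<in>permutations_of_set (?R - {g}). ?J (F \<union> kruskal E (g # xs))) \<le>
      fact r * (?J F + ?b (card F) + ?\<Delta> g)" if g: "g \<in> ?R" for g
  proof -
    let ?F = "F \<union> (if cross E g then {g} else {})"
    have eq: "?K - insert g E = ?R - {g}" by auto
    have FK: "F \<subseteq> ?K" "g \<in> ?K" "g \<notin> F" using F g by auto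
    have c: "card (?R - {g}) = r" using g R finR by simp
    have "(\<Sum>xs\<in>permutations_of_set (?R - {g}). ?J (F \<union> kruskal E (g # xs))) \<le>
        fact r * (?J ?F + ?b (card ?F))"
      using Suc.hyps(1)[of "insert g E" ?F] kruskal_state_insert[OF fin Suc.prems, of g] g c
      by (simp add: eq Un_assoc del: kruskal.simps(1))
    also have "?J ?F + ?b (card ?F) = ?J F + ?b (card F) + ?\<Delta> g"
      using card_adjacent_pairs_insert[OF finF FK] finF FK by simp
    finally show ?thesis .
  qed
  have "(\<Sum>xs\<in>permutations_of_set ?R. ?J (F \<union> kruskal E xs)) =
      (\<Sum>g\<in>?R. \<Sum>xs\<in>permutations_of_set (?R - {g}). ?J (F \<union> kruskal E (g # xs)))"
    by (rule sum_permutations_of_set_rec[OF finR R(1)])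
  also have "\<dots> \<le> (\<Sum>g\<in>?R. fact r * (?J F + ?b (card F) + ?\<Delta> g))"
    by (rule sum_mono[OF step])
  also have "\<dots> = fact r * (real (Suc r) * (?J F + ?b (card F)) + (\<Sum>g\<in>?R. ?\<Delta> g))"
    by (simp only: sum_distrib_left[symmetric] sum.distrib sum_constant R(2) distrib_left)
  \<comment> \<open>No examined edge crosses and rejected edges contribute 0, so all crossing edges
    enter with equal weight.\<close>
  also have "(\<Sum>g\<in>?R. ?\<Delta> g) = (\<Sum>g | g \<in> ?K \<and> cross E g. ?\<Delta> g)"
    using finK not_cross_if_mem[of _ V E] by (intro sum.mono_neutral_cong_right) auto
  also have "\<dots> = (\<Sum>g | g \<in> ?K \<and> cross E g. 2 * (\<Sum>z\<in>g. real (vertex_degree F z))) -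
      real (card {g \<in> ?K. cross E g}) * (?b (card F) - ?b (Suc (card F)))"
    by (simp add: sum_subtractf)
  finally have "(\<Sum>xs\<in>permutations_of_set ?R. ?J (F \<union> kruskal E xs)) \<le>
      fact r * (real (Suc r) * (?J F + ?b (card F)) +
        ((\<Sum>g | g \<in> ?K \<and> cross E g. 2 * (\<Sum>z\<in>g. real (vertex_degree F z))) -
      real (card {g \<in> ?K. cross E g}) * (?b (card F) - ?b (Suc (card F)))))" .
  also have "\<dots> \<le> fact r * (real (Suc r) * (?J F + ?b (card F)))"
    using sum_cross_le_pair_bound[OF fin n Suc.prems] by simp
  also have "\<dots> = fact (card ?R) * (?J F + ?b (card F))"
    using R(2) by simp
  finally show ?case .
qed

section \<open>Vertex symmetry\<close>

text \<open>Any map carries walks to walks; the converse direction applies this to the inverse of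
  \<open>\<pi>\<close>.\<close>

lemma conn_image:
  fixes \<pi> :: "'v \<Rightarrow> 'v"
  assumes "bij \<pi>"
  shows "(\<pi> x, \<pi> y) \<in> conn ((`) \<pi> ` E) \<longleftrightarrow> (x, y) \<in> conn E"
proof -
  have mono: "(\<rho> x, \<rho> y) \<in> conn ((`) \<rho> ` E)" if "(x, y) \<in> conn E" for \<rho> :: "'v \<Rightarrow> 'v" and x y E
    using that unfolding conn_def
  proof (induction rule: rtrancl_induct)
    case (step y z)
    have "{\<rho> y, \<rho> z} = \<rho> ` {y, z}" by simp
    then have "{\<rho> y, \<rho> z} \<in> (`) \<rho> ` E" using step.hyps(2) by blast
    then show ?case using step.IH by (simp add: rtrancl_into_rtrancl)
  qed simp
  have inv: "inv \<pi> (\<pi> z) = z" for z using assms by (simp add: bij_is_inj)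
  then have "(`) (inv \<pi>) ` ((`) \<pi> ` E) = E" by (simp add: image_image)
  then show ?thesis using mono[of x y E \<pi>] mono[of "\<pi> x" "\<pi> y" "(`) \<pi> ` E" "inv \<pi>"] inv by auto
qed

lemma cross_image:
  fixes \<pi> :: "'v \<Rightarrow> 'v"
  assumes "bij \<pi>" and "g \<in> complete_edges V"
  shows "cross ((`) \<pi> ` E) (\<pi> ` g) \<longleftrightarrow> cross E g"
  using assms(2) by (elim complete_edgesD) (simp add: conn_image[OF assms(1)])

lemma kruskal_image:
  fixes \<pi> :: "'v \<Rightarrow> 'v"
  assumes "bij \<pi>" and "set xs \<subseteq> complete_edges V"
  shows "kruskal ((`) \<pi> ` E) (map ((`) \<pi>) xs) = (`) \<pi> ` kruskal E xs"
  using assms(2)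
proof (induction xs arbitrary: E)
  case (Cons g xs)
  from Cons.IH[of "insert g E"] Cons.prems have "kruskal ((`) \<pi> ` insert g E) (map ((`) \<pi>) xs) = (`) \<pi> ` kruskal (insert g E) xs"
    by simp
  then show ?case using cross_image[OF assms(1), of g V E] Cons.prems by (auto simp: image_Un)
qed simp

text \<open>Divided by the number of all orders, this is the probability that the minimum spanning
  tree contains \<open>S\<close>; see \<open>prob_mst_supset\<close>.\<close>

definition count_orders :: "'v set \<Rightarrow> 'v set set \<Rightarrow> nat" where
  "count_orders V S = card {xs \<in> permutations_of_set (complete_edges V). S \<subseteq> kruskal {} xs}"

text \<open>Renaming vertices permutes the edges, hence their orders, and the accepted edges are
  renamed along with the order.\<close>

lemma count_orders_image:
  assumes "\<pi> permutes V"
  shows "count_orders V ((`) \<pi> ` S) = count_orders V S"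
proof -
  have bij: "bij \<pi>" and inj: "inj \<pi>" using assms by (simp_all add: permutes_bij permutes_inj)
  have inj_image: "inj ((`) \<pi>)" using inj by (simp add: inj_on_def inj_image_eq_iff)
  let ?K = "complete_edges V"
  have sub: "(`) \<rho> ` ?K \<subseteq> ?K" if \<rho>: "\<rho> permutes V" for \<rho>
  proof (rule image_subsetI)
    fix g assume "g \<in> ?K"
    then obtain u v where "g = {u, v}" "u \<in> V" "v \<in> V" "u \<noteq> v" by (rule complete_edgesD)
    then show "\<rho> ` g \<in> ?K"
      using permutes_in_image[OF \<rho>] inj_eq[OF permutes_inj[OF \<rho>]] by simp
  qed
  have "?K = (`) \<pi> ` ((`) (inv \<pi>) ` ?K)"
    using permutes_inverses(1)[OF assms] by (simp add: image_image)
  also have "\<dots> \<subseteq> (`) \<pi> ` ?K"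
    by (rule image_mono[OF sub[OF permutes_inv[OF assms]]])
  finally have K: "(`) \<pi> ` ?K = ?K" using sub[OF assms] by (rule subset_antisym[rotated])
  let ?P = "permutations_of_set ?K"
  have P: "map ((`) \<pi>) ` ?P = ?P"
    using permutations_of_set_image_inj[of "(`) \<pi>" ?K] inj_image K by (simp add: inj_on_subset)
  have kr: "(`) \<pi> ` S \<subseteq> kruskal {} (map ((`) \<pi>) xs) \<longleftrightarrow> S \<subseteq> kruskal {} xs" if "xs \<in> ?P" for xs
    using kruskal_image[OF bij, of xs V "{}"] that inj_image
    by (simp add: permutations_of_setD inj_image_subset_iff)
  let ?Q = "\<lambda>xs. (`) \<pi> ` S \<subseteq> kruskal {} xs"
  have "{xs \<in> map ((`) \<pi>) ` ?P. ?Q xs} = map ((`) \<pi>) ` {xs \<in> ?P. ?Q (map ((`) \<pi>) xs)}"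
    by blast
  also have "{xs \<in> ?P. ?Q (map ((`) \<pi>) xs)} = {xs \<in> ?P. S \<subseteq> kruskal {} xs}"
    using kr by (intro Collect_cong) auto
  finally have "{xs \<in> ?P. ?Q xs} = map ((`) \<pi>) ` {xs \<in> ?P. S \<subseteq> kruskal {} xs}"
    unfolding P .
  moreover have "inj_on (map ((`) \<pi>)) X" for X
    using inj_mapI[OF inj_image] by (rule inj_on_subset) simp
  ultimately show ?thesis
    unfolding count_orders_def by (simp only: card_image)
qed

text \<open>Three transpositions place \<open>a\<close>, \<open>b\<close> and \<open>c\<close> in
  turn, each fixing the images already placed.\<close>

lemma ex_permutes_triple:
  assumes "a \<in> V" "b \<in> V" "c \<in> V" "distinct [a, b, c]"
    and "a' \<in> V" "b' \<in> V" "c' \<in> V" "distinct [a', b', c']"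
  shows "\<exists>\<pi>. \<pi> permutes V \<and> \<pi> a = a' \<and> \<pi> b = b' \<and> \<pi> c = c'"
proof -
  define p where "p = Transposition.transpose a a'"
  define q where "q = Transposition.transpose (p b) b' \<circ> p"
  define r where "r = Transposition.transpose (q c) c' \<circ> q"
  have p: "p permutes V" unfolding p_def using assms by (intro permutes_swap_id)
  have q: "q permutes V" unfolding q_def using assms p
    by (intro permutes_compose permutes_swap_id) (simp_all add: permutes_in_image)
  have r: "r permutes V" unfolding r_def using assms q
    by (intro permutes_compose permutes_swap_id) (simp_all add: permutes_in_image)
  have pa: "p a = a'" by (simp add: p_def)
  then have "p b \<noteq> a'" using permutes_inj[OF p] assms by (metis distinct_length_2_or_more injD)
  then have qa: "q a = a'" using assms pa by (auto simp: q_def Transposition.transpose_def)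
  have qb: "q b = b'" by (simp add: q_def)
  have "q c \<noteq> a'" "q c \<noteq> b'" using permutes_inj[OF q] assms qa qb by (metis distinct_length_2_or_more injD)+
  then have "r a = a'" "r b = b'" using assms qa qb by (auto simp: r_def Transposition.transpose_def)
  moreover have "r c = c'" by (simp add: r_def)
  ultimately show ?thesis using r by blast
qed

lemma adjacent_pairsE:
  assumes "(e, f) \<in> adjacent_pairs (complete_edges V)"
  obtains a b c where "e = {a, b}" "f = {a, c}" "a \<in> V" "b \<in> V" "c \<in> V" "distinct [a, b, c]"
proof -
  have e: "e \<in> complete_edges V" and f: "f \<in> complete_edges V" and "e \<noteq> f" "e \<inter> f \<noteq> {}"
    using assms by (auto simp: adjacent_pairs_def)
  then obtain a where a: "a \<in> e" "a \<in> f" by auto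
  obtain b where b: "e = {a, b}" "a \<noteq> b" using e a by (elim complete_edgesD) auto
  obtain c where c: "f = {a, c}" "a \<noteq> c" using f a by (elim complete_edgesD) auto
  show thesis using that[of a b c] b c e f \<open>e \<noteq> f\<close> by auto
qed

text \<open>Vertex permutations act transitively on triples of distinct vertices, hence on ordered
  pairs of adjacent edges: the shared vertex goes to the shared vertex.\<close>

lemma count_orders_adjacent:
  assumes "(e, f) \<in> adjacent_pairs (complete_edges V)" and "(e', f') \<in> adjacent_pairs (complete_edges V)"
  shows "count_orders V {e, f} = count_orders V {e', f'}"
    and "count_orders V {e} = count_orders V {e'}"
proof -
  obtain a b c where 1: "e = {a, b}" "f = {a, c}" "a \<in> V" "b \<in> V" "c \<in> V" "distinct [a, b, c]"
    using assms(1) by (rule adjacent_pairsE)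
  obtain a' b' c' where 2: "e' = {a', b'}" "f' = {a', c'}" "a' \<in> V" "b' \<in> V" "c' \<in> V" "distinct [a', b', c']"
    using assms(2) by (rule adjacent_pairsE)
  obtain \<pi> where \<pi>: "\<pi> permutes V" "\<pi> a = a'" "\<pi> b = b'" "\<pi> c = c'"
    using ex_permutes_triple[OF 1(3-6) 2(3-6)] by blast
  have "(`) \<pi> ` {e, f} = {e', f'}" "(`) \<pi> ` {e} = {e'}" using 1(1,2) 2(1,2) \<pi> by auto
  then show "count_orders V {e, f} = count_orders V {e', f'}" "count_orders V {e} = count_orders V {e'}"
    using count_orders_image[OF \<pi>(1)] by metis+
qed

section \<open>The two counts of edge orders\<close>

lemma card_complete_edges:
  assumes "finite V"
  shows "2 * real (card (complete_edges V)) = real (card V) * (real (card V) - 1)"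
proof -
  have "complete_edges V = {e. e \<subseteq> V \<and> card e = 2}" by (simp add: complete_edges_def)
  then have "2 * card (complete_edges V) = card V * (card V - 1)"
    using n_subsets[OF assms, of 2] dvd_mult_div_cancel[of 2 "card V * (card V - 1)"]
    by (cases "card V") (simp_all add: choose_two)
  then have "2 * real (card (complete_edges V)) = real (card V) * real (card V - 1)"
    by (metis of_nat_mult of_nat_numeral)
  then show ?thesis by (cases "card V") auto
qed

text \<open>An ordered adjacent pair is a triple of distinct vertices: the shared vertex, recovered
  as the intersection, and the two other ends.\<close>

lemma card_adjacent_pairs_complete:
  assumes "finite V"
  shows "card (adjacent_pairs (complete_edges V)) = card V * (card V - 1) * (card V - 2)"
proof -
  let ?S = "SIGMA a:V. SIGMA b:V - {a}. V - {a, b}"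
  let ?f = "\<lambda>(a, b, c). ({a, b}, {a, c})"
  have "?f ` ?S = adjacent_pairs (complete_edges V)"
  proof
    show "?f ` ?S \<subseteq> adjacent_pairs (complete_edges V)"
      by (auto simp: adjacent_pairs_def doubleton_eq_iff)
    show "adjacent_pairs (complete_edges V) \<subseteq> ?f ` ?S"
    proof
      fix z assume z: "z \<in> adjacent_pairs (complete_edges V)"
      obtain e f where ef: "z = (e, f)" by (cases z)
      obtain a b c where "e = {a, b}" "f = {a, c}" "a \<in> V" "b \<in> V" "c \<in> V" "distinct [a, b, c]"
        using z unfolding ef by (rule adjacent_pairsE)
      then show "z \<in> ?f ` ?S" unfolding ef by (intro image_eqI[of _ _ "(a, b, c)"]) auto
    qed
  qed
  moreover have "inj_on ?f ?S"
  proof (rule inj_onI)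
    fix z z' assume z: "z \<in> ?S" "z' \<in> ?S" and eq: "?f z = ?f z'"
    obtain a b c a' b' c' where zz: "z = (a, b, c)" "z' = (a', b', c')"
      by (metis prod.exhaust)
    have "{a, b} \<inter> {a, c} = {a}" "{a', b'} \<inter> {a', c'} = {a'}" using z by (auto simp: zz)
    moreover have "{a, b} = {a', b'}" "{a, c} = {a', c'}" using eq by (simp_all add: zz)
    ultimately have "a = a'" by simp
    then show "z = z'" using \<open>{a, b} = {a', b'}\<close> \<open>{a, c} = {a', c'}\<close> by (auto simp: zz doubleton_eq_iff)
  qed
  ultimately have "card (adjacent_pairs (complete_edges V)) = card ?S"
    using card_image[of ?f ?S] by simp
  also have "\<dots> = (\<Sum>a\<in>V. \<Sum>b\<in>V - {a}. card (V - {a, b}))"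
    using assms by simp
  also have "\<dots> = (\<Sum>a\<in>V. \<Sum>b\<in>V - {a}. card V - 2)"
    using assms by (intro sum.cong refl) (auto simp: card_Diff_subset)
  also have "\<dots> = card V * (card V - 1) * (card V - 2)"
    using assms by simp
  finally show ?thesis .
qed

text \<open>Double counting of the pairs of an index and an order whose accepted edges include
  \<open>S i\<close>.\<close>

lemma sum_count_orders:
  assumes "finite V" and "finite I"
  shows "(\<Sum>i\<in>I. count_orders V (S i)) =
    (\<Sum>xs\<in>permutations_of_set (complete_edges V). card {i \<in> I. S i \<subseteq> kruskal {} xs})"
proof -
  let ?P = "permutations_of_set (complete_edges V)"
  have "(\<Sum>i\<in>I. count_orders V (S i)) = (\<Sum>i\<in>I. \<Sum>xs\<in>?P. if S i \<subseteq> kruskal {} xs then 1 else 0)"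
    by (simp add: count_orders_def sum.If_cases Int_def)
  also have "\<dots> = (\<Sum>xs\<in>?P. \<Sum>i\<in>I. if S i \<subseteq> kruskal {} xs then 1 else 0)" by (rule sum.swap)
  finally show ?thesis using assms(2) by (simp add: sum.If_cases Int_def)
qed

lemma card_kruskal:
  assumes "finite V" and "V \<noteq> {}" and "xs \<in> permutations_of_set (complete_edges V)"
  shows "card (kruskal {} xs) = card V - 1"
proof -
  have "kruskal_state V (complete_edges V) (kruskal {} xs)"
    using kruskal_state_kruskal[OF assms(1) kruskal_state_empty, of xs] assms(3)
    by (simp add: permutations_of_setD)
  then have "1 + real (card (kruskal {} xs)) = real (card V)"
    using num_components_complete[OF assms(1,2)] by (simp add: kruskal_state_def)
  then show ?thesis by linarith
qed

text \<open>Every edge has an adjacent one, so by symmetry all edges have the same count; each order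
  accepts \<open>card V - 1\<close> of the n(n - 1)/2 edges.\<close>

lemma count_orders_edge:
  assumes fin: "finite V" and "card V \<ge> 3" and ef: "(e, f) \<in> adjacent_pairs (complete_edges V)"
  shows "real (count_orders V {e}) = 2 / real (card V) * fact (card (complete_edges V))"
proof -
  let ?K = "complete_edges V"
  have "V \<noteq> {}" using assms(2) by auto
  have finK: "finite ?K" using fin by (rule finite_complete_edges)
  have "count_orders V {g} = count_orders V {e}" if g: "g \<in> ?K" for g
  proof -
    obtain a b where ab: "g = {a, b}" "a \<in> V" "b \<in> V" "a \<noteq> b" using g by (rule complete_edgesD)
    have "\<not> V \<subseteq> {a, b}" using assms(2) card_mono[of "{a, b}" V] ab(4) by auto
    then obtain c where "c \<in> V" "c \<noteq> a" "c \<noteq> b" by auto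
    then have "({a, b}, {a, c}) \<in> adjacent_pairs ?K"
      using ab by (auto simp: adjacent_pairs_def doubleton_eq_iff)
    then show ?thesis using count_orders_adjacent(2)[OF _ ef] ab(1) by blast
  qed
  then have "card ?K * count_orders V {e} = (\<Sum>g\<in>?K. count_orders V {g})" by simp
  also have "\<dots> = (\<Sum>xs\<in>permutations_of_set ?K. card {g \<in> ?K. {g} \<subseteq> kruskal {} xs})"
    by (rule sum_count_orders[OF fin finK])
  also have "\<dots> = (\<Sum>xs\<in>permutations_of_set ?K. card V - 1)"
  proof (rule sum.cong[OF refl])
    fix xs assume xs: "xs \<in> permutations_of_set ?K"
    then have "{g \<in> ?K. {g} \<subseteq> kruskal {} xs} = kruskal {} xs"
      using kruskal_subset[of "{}" xs] by (auto simp: permutations_of_setD)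
    then show "card {g \<in> ?K. {g} \<subseteq> kruskal {} xs} = card V - 1"
      using card_kruskal[OF fin \<open>V \<noteq> {}\<close> xs] by simp
  qed
  also have "\<dots> = fact (card ?K) * (card V - 1)" using finK by simp
  finally have "real (card ?K * count_orders V {e}) = real (fact (card ?K) * (card V - 1))"
    by (rule arg_cong)
  then have "real (card ?K) * real (count_orders V {e}) = fact (card ?K) * (real (card V) - 1)"
    using assms(2) by (simp add: of_nat_diff)
  moreover have "(real (card V) - 1) * (real (card V) * real (count_orders V {e})) =
      2 * (real (card ?K) * real (count_orders V {e}))"
    using card_complete_edges[OF fin] by (simp flip: mult.assoc)
  ultimately have "(real (card V) - 1) * (real (card V) * real (count_orders V {e})) =
      (real (card V) - 1) * (2 * fact (card ?K))" by simp
  then have "real (card V) * real (count_orders V {e}) = 2 * fact (card ?K)"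
    using assms(2) by (subst (asm) mult_left_cancel) auto
  then show ?thesis using assms(2) by (simp add: field_simps)
qed

text \<open>By symmetry every ordered adjacent pair has the same count, so the total number of
  adjacent pairs over all Kruskal trees determines it.\<close>

lemma count_orders_adjacent_less:
  assumes fin: "finite V" and n: "card V \<ge> 3" and ef: "(e, f) \<in> adjacent_pairs (complete_edges V)"
  shows "real (count_orders V {e, f}) < 4 / (real (card V))\<^sup>2 * fact (card (complete_edges V))"
proof -
  let ?K = "complete_edges V"
  let ?A = "adjacent_pairs ?K"
  define N where "N = real (card V)"
  have N: "N \<ge> 3" using n by (simp add: N_def)
  have finK: "finite ?K" using fin by (rule finite_complete_edges)
  have finA: "finite ?A" using finK by (rule finite_adjacent_pairs)
  have "card ?A * count_orders V {e, f} = (\<Sum>z\<in>?A. count_orders V {fst z, snd z})"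
    using count_orders_adjacent(1)[OF _ ef] by simp
  also have "\<dots> = (\<Sum>xs\<in>permutations_of_set ?K. card {z \<in> ?A. {fst z, snd z} \<subseteq> kruskal {} xs})"
    by (rule sum_count_orders[OF fin finA])
  also have "\<dots> = (\<Sum>xs\<in>permutations_of_set ?K. card (adjacent_pairs (kruskal {} xs)))"
  proof (rule sum.cong[OF refl])
    fix xs assume xs: "xs \<in> permutations_of_set ?K"
    then have "{z \<in> ?A. {fst z, snd z} \<subseteq> kruskal {} xs} = adjacent_pairs (kruskal {} xs)"
      using kruskal_subset[of "{}" xs] by (auto simp: permutations_of_setD adjacent_pairs_def)
    then show "card {z \<in> ?A. {fst z, snd z} \<subseteq> kruskal {} xs} = card (adjacent_pairs (kruskal {} xs))"
      by simp
  qed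
  finally have "real (card ?A) * real (count_orders V {e, f}) =
      (\<Sum>xs\<in>permutations_of_set ?K. real (card (adjacent_pairs (kruskal {} xs))))"
    by (simp flip: of_nat_mult)
  also have "\<dots> \<le> fact (card ?K) * pair_bound (card V) 0"
    using sum_adjacent_pairs_kruskal_le[OF fin n kruskal_state_empty] by (simp add: adjacent_pairs_def)
  \<comment> \<open>Strictness enters here: the positive correction in \<open>pair_bound\<close> at
    0 is dropped.\<close>
  also have "\<dots> < fact (card ?K) * (8 * (N - 1) - 4 / N * (N * (N + 1) - 2))"
    using N by (intro mult_strict_left_mono) (auto simp: pair_bound_def N_def Let_def)
  \<comment> \<open>The uncorrected bound is 4(N - 1)(N - 2)/N, that is,
    \<open>4 / N\<^sup>2\<close> for each ordered adjacent pair.\<close>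
  also have "8 * (N - 1) - 4 / N * (N * (N + 1) - 2) = 4 / N\<^sup>2 * (N * (N - 1) * (N - 2))"
    using N by (simp add: field_simps power2_eq_square)
  also have "N * (N - 1) * (N - 2) = real (card ?A)"
    using n by (simp add: card_adjacent_pairs_complete[OF fin] N_def of_nat_diff)
  finally have "real (card ?A) * real (count_orders V {e, f}) <
      real (card ?A) * (4 / N\<^sup>2 * fact (card ?K))" by (simp add: mult_ac)
  then have "real (count_orders V {e, f}) < 4 / N\<^sup>2 * fact (card ?K)"
    by (rule mult_left_less_imp_less) simp
  then show ?thesis by (simp add: N_def)
qed

section \<open>Random weights\<close>

context prob_space
begin

text \<open>By independence the joint law is the product law, for which the diagonal is null because
  all its sections are null.\<close>

lemma AE_indep_atomless_neq:
  fixes X Y :: "'a \<Rightarrow> real"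
  assumes "indep_var borel X borel Y" and "\<And>x. prob {\<omega> \<in> space M. Y \<omega> = x} = 0"
  shows "AE \<omega> in M. X \<omega> \<noteq> Y \<omega>"
proof -
  have [measurable]: "random_variable borel X" "random_variable borel Y"
    and eq: "distr M borel X \<Otimes>\<^sub>M distr M borel Y = distr M (borel \<Otimes>\<^sub>M borel) (\<lambda>\<omega>. (X \<omega>, Y \<omega>))"
    using assms(1) by (simp_all add: indep_var_distribution_eq)
  interpret X: prob_space "distr M borel X" by (rule prob_space_distr) measurable
  interpret Y: prob_space "distr M borel Y" by (rule prob_space_distr) measurable
  interpret P: pair_sigma_finite "distr M borel X" "distr M borel Y" ..
  have null: "AE y in distr M borel Y. x \<noteq> y" for x
  proof -
    have "{\<omega> \<in> space M. Y \<omega> = x} \<in> null_sets M"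
      using assms(2)[of x] by (intro null_setsI) (simp_all add: emeasure_eq_measure)
    from AE_not_in[OF this] AE_space have "AE \<omega> in M. x \<noteq> Y \<omega>"
      by eventually_elim auto
    then show ?thesis by (subst AE_distr_iff) auto
  qed
  have [measurable]: "{z :: real \<times> real. fst z \<noteq> snd z} \<in> sets (borel \<Otimes>\<^sub>M borel)"
    unfolding borel_prod by (intro borel_open open_Collect_neq continuous_intros)
  have "AE z in distr M borel X \<Otimes>\<^sub>M distr M borel Y. fst z \<noteq> snd z"
    by (rule P.AE_pair_measure) (auto simp: null space_pair_measure)
  then have "AE \<omega> in M. fst (X \<omega>, Y \<omega>) \<noteq> snd (X \<omega>, Y \<omega>)"
    unfolding eq by (subst (asm) AE_distr_iff) auto
  then show ?thesis by simp
qed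

text \<open>Strict inequalities keep the events of different orders disjoint; ties are left to a
  null set.\<close>

definition order_event :: "('i \<Rightarrow> 'a \<Rightarrow> real) \<Rightarrow> 'i list \<Rightarrow> 'a set" where
  "order_event W xs = {\<omega> \<in> space M. sorted_wrt (\<lambda>g h. W g \<omega> < W h \<omega>) xs}"

lemma order_event_measurable:
  assumes "\<And>g. g \<in> set xs \<Longrightarrow> random_variable borel (W g)"
  shows "order_event W xs \<in> events"
  using assms
proof (induction xs)
  case (Cons g xs)
  have "order_event W (g # xs) = {\<omega> \<in> space M. \<forall>h\<in>set xs. W g \<omega> < W h \<omega>} \<inter> order_event W xs"
    by (auto simp: order_event_def)
  moreover have "{\<omega> \<in> space M. \<forall>h\<in>set xs. W g \<omega> < W h \<omega>} \<in> events"
    using Cons.prems by (intro sets.sets_Collect_finite_All borel_measurable_less) auto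
  ultimately show ?case using Cons by auto
qed (simp add: order_event_def)

text \<open>Listing the weights along \<open>xs\<close> gives a vector whose law does not depend on \<open>xs\<close>.\<close>

lemma prob_order_event_eq:
  assumes indep: "indep_vars (\<lambda>_. borel) W K" and D: "\<forall>g\<in>K. distr M borel (W g) = D"
    and "K \<noteq> {}" and xs: "xs \<in> permutations_of_set K"
  shows "prob (order_event W xs) =
    measure (PiM {..<card K} (\<lambda>_. D)) {x \<in> space (PiM {..<card K} (\<lambda>_. borel)). \<forall>i j. i < j \<and> j < card K \<longrightarrow> x i < x j}"
proof -
  let ?N = "{..<card K}"
  have rv: "random_variable borel (W g)" if "g \<in> K" for g
    using indep that by (simp add: indep_vars_def)
  obtain g0 where "g0 \<in> K" using \<open>K \<noteq> {}\<close> by auto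
  have "D = distr M borel (W g0)" using D \<open>g0 \<in> K\<close> by simp
  then have pD: "prob_space D" and sD: "sets D = sets borel"
    using prob_space_distr[OF rv[OF \<open>g0 \<in> K\<close>]] by simp_all
  have sets: "sets (PiM I (\<lambda>_. D)) = sets (PiM I (\<lambda>_. borel))" for I :: "'j set"
    by (rule sets_PiM_cong) (simp_all add: sD)
  have dist: "distinct xs" "set xs = K" using xs by (simp_all add: permutations_of_setD)
  have len: "length xs = card K" using dist distinct_card by fastforce
  have inj: "inj_on (\<lambda>i. xs ! i) ?N" using dist len by (simp add: inj_on_nth)
  have into: "(\<lambda>i. xs ! i) \<in> ?N \<rightarrow> K" using dist len by auto
  let ?r = "\<lambda>x. \<lambda>i\<in>?N. x (xs ! i)" and ?v = "\<lambda>\<omega>. \<lambda>g\<in>K. W g \<omega>"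
  have v: "?v \<in> measurable M (PiM K (\<lambda>_. borel))" by (rule measurable_restrict) (rule rv)
  have r: "?r \<in> measurable (PiM K (\<lambda>_. borel)) (PiM ?N (\<lambda>_. borel))"
    using into by (intro measurable_restrict measurable_component_singleton) auto
  have "distr M (PiM K (\<lambda>_. borel)) ?v = PiM K (\<lambda>g. distr M borel (W g))"
    using indep_vars_iff_distr_eq_PiM'[OF \<open>K \<noteq> {}\<close>, where M' = "\<lambda>_. borel" and X = W] rv indep by simp
  also have "\<dots> = PiM K (\<lambda>_. D)" by (rule PiM_cong) (simp_all add: D)
  finally have law: "distr M (PiM K (\<lambda>_. borel)) ?v = PiM K (\<lambda>_. D)" .
  \<comment> \<open>A bijective reindexing of identical factors preserves the product law, and the
    left side no longer mentions \<open>xs\<close>.\<close>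
  have "PiM ?N (\<lambda>_. D) = distr (PiM K (\<lambda>_. D)) (PiM ?N (\<lambda>_. D)) ?r"
    by (rule distr_PiM_reindex[OF pD inj into, symmetric])
  also have "\<dots> = distr (PiM K (\<lambda>_. D)) (PiM ?N (\<lambda>_. borel)) ?r"
    by (rule distr_cong) (simp_all add: sets)
  also have "\<dots> = distr M (PiM ?N (\<lambda>_. borel)) (?r \<circ> ?v)"
    unfolding law[symmetric] by (rule distr_distr[OF r v])
  finally have law': "PiM ?N (\<lambda>_. D) = distr M (PiM ?N (\<lambda>_. borel)) (?r \<circ> ?v)" .
  let ?S = "{x \<in> space (PiM ?N (\<lambda>_. borel)). \<forall>i j. i < j \<and> j < card K \<longrightarrow> x i < (x j :: real)}"
  have comp: "(\<lambda>x. x i :: real) \<in> borel_measurable (PiM ?N (\<lambda>_. borel))" if "i \<in> ?N" for i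
    using that by (rule measurable_component_singleton)
  have less: "{x \<in> space (PiM ?N (\<lambda>_. borel)). x i < (x j :: real)} \<in> sets (PiM ?N (\<lambda>_. borel))"
    if "i \<in> ?N" "j \<in> ?N" for i j
    by (rule borel_measurable_less[OF comp[OF that(1)] comp[OF that(2)]])
  have "?S = {x \<in> space (PiM ?N (\<lambda>_. borel)). \<forall>j\<in>?N. \<forall>i\<in>{..<j}. x i < x j}" by auto
  also have "\<dots> \<in> sets (PiM ?N (\<lambda>_. borel))"
    by (intro sets.sets_Collect_finite_All less) auto
  finally have S: "?S \<in> sets (PiM ?N (\<lambda>_. borel))" .
  have eq: "(?r \<circ> ?v) \<omega> i = W (xs ! i) \<omega>" if "i < card K" for i \<omega>
    using that into by auto
  have "(?r \<circ> ?v) -` ?S \<inter> space M = order_event W xs"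
    using measurable_space[OF measurable_comp[OF v r]] eq
    by (auto simp: order_event_def sorted_wrt_iff_nth_less len)
  then show ?thesis
    unfolding law' measure_distr[OF measurable_comp[OF v r] S] by simp
qed

lemma AE_inj_weights:
  assumes indep: "indep_vars (\<lambda>_. borel) W K" and D: "\<forall>g\<in>K. distr M borel (W g) = D"
    and atomless: "\<And>x. measure D {x} = 0" and "finite K"
  shows "AE \<omega> in M. inj_on (\<lambda>g. W g \<omega> :: real) K"
proof -
  have rv: "random_variable borel (W g)" if "g \<in> K" for g
    using indep that by (simp add: indep_vars_def)
  have "AE \<omega> in M. g \<noteq> h \<longrightarrow> W g \<omega> \<noteq> W h \<omega>" if g: "g \<in> K" and h: "h \<in> K" for g h
  proof (cases "g = h")
    case False
    let ?B = "\<lambda>_. borel :: real measure"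
    \<comment> \<open>Two members of the family are independent: restrict it to two disjoint
      singletons, then evaluate at their elements.\<close>
    have "indep_var (PiM {g} ?B) (\<lambda>\<omega>. \<lambda>i\<in>{g}. W i \<omega>) (PiM {h} ?B) (\<lambda>\<omega>. \<lambda>i\<in>{h}. W i \<omega>)"
      using g h False by (intro indep_var_restrict[OF indep]) auto
    then have "indep_var borel ((\<lambda>x. x g) \<circ> (\<lambda>\<omega>. \<lambda>i\<in>{g}. W i \<omega>)) borel ((\<lambda>x. x h) \<circ> (\<lambda>\<omega>. \<lambda>i\<in>{h}. W i \<omega>))"
      by (rule indep_var_compose) (auto intro: measurable_component_singleton)
    then have "indep_var borel (W g) borel (W h)" by (simp add: comp_def)
    moreover have "prob {\<omega> \<in> space M. W h \<omega> = x} = 0" for x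
    proof -
      have "measure (distr M borel (W h)) {x} = prob (W h -` {x} \<inter> space M)"
        using rv[OF h] by (rule measure_distr) simp
      also have "W h -` {x} \<inter> space M = {\<omega> \<in> space M. W h \<omega> = x}" by auto
      finally show ?thesis using D h atomless by simp
    qed
    ultimately show ?thesis using AE_indep_atomless_neq by auto
  qed simp
  then have "AE \<omega> in M. \<forall>g\<in>K. \<forall>h\<in>K. g \<noteq> h \<longrightarrow> W g \<omega> \<noteq> W h \<omega>"
    using \<open>finite K\<close> by (simp add: AE_finite_all)
  then show ?thesis by eventually_elim (auto simp: inj_on_def)
qed

lemma ex_order_event:
  assumes "finite K" and "inj_on (\<lambda>g. W g \<omega>) K" and "\<omega> \<in> space M"
  shows "\<exists>xs\<in>permutations_of_set K. \<omega> \<in> order_event W xs"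
proof -
  obtain ys where ys: "set ys = K" "distinct ys"
    using finite_distinct_list[OF assms(1)] by auto
  let ?xs = "sort_key (\<lambda>g. W g \<omega>) ys"
  have "sorted (map (\<lambda>g. W g \<omega>) ?xs)" "distinct (map (\<lambda>g. W g \<omega>) ?xs)"
    using ys assms(2) by (simp_all add: distinct_map)
  then have "sorted_wrt (<) (map (\<lambda>g. W g \<omega>) ?xs)" by (simp add: strict_sorted_iff)
  then have "\<omega> \<in> order_event W ?xs" using assms(3) by (simp add: order_event_def sorted_wrt_map)
  moreover have "?xs \<in> permutations_of_set K" using ys by (intro permutations_of_setI) simp_all
  ultimately show ?thesis by blast
qed

text \<open>Two strictly increasing lists of the same weights coincide, and strict increase makes
  the weights determine the edges.\<close>

lemma disjoint_order_events:
  "disjoint_family_on (order_event W) (permutations_of_set K)"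
  unfolding disjoint_family_on_def
proof (intro ballI impI equals0I)
  fix xs ys \<omega>
  assume "xs \<in> permutations_of_set K" "ys \<in> permutations_of_set K" "xs \<noteq> ys"
    and \<omega>: "\<omega> \<in> order_event W xs \<inter> order_event W ys"
  then have set: "set xs = set ys" by (simp add: permutations_of_setD)
  have sorted: "sorted_wrt (<) (map (\<lambda>g. W g \<omega>) xs)" "sorted_wrt (<) (map (\<lambda>g. W g \<omega>) ys)"
    using \<omega> by (simp_all add: order_event_def sorted_wrt_map)
  then have "map (\<lambda>g. W g \<omega>) xs = map (\<lambda>g. W g \<omega>) ys"
    using set by (intro strict_sorted_equal) auto
  moreover have "inj_on (\<lambda>g. W g \<omega>) (set xs \<union> set ys)"
    using sorted(1) set by (simp add: strict_sorted_iff distinct_map)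
  ultimately show False using \<open>xs \<noteq> ys\<close> by (simp add: map_inj_on)
qed

text \<open>The order events are disjoint, equally likely and cover almost everything, so each has
  probability 1 over their number.\<close>

lemma prob_order_event:
  assumes indep: "indep_vars (\<lambda>_. borel) W K" and D: "\<forall>g\<in>K. distr M borel (W g) = D"
    and atomless: "\<And>x. measure D {x} = 0" and "finite K" and "K \<noteq> {}"
    and P: "P \<subseteq> permutations_of_set K"
  shows "prob (\<Union>xs\<in>P. order_event W xs) = real (card P) / fact (card K)"
proof -
  let ?P = "permutations_of_set K"
  have rv: "random_variable borel (W g)" if "g \<in> K" for g
    using indep that by (simp add: indep_vars_def)
  have meas: "order_event W xs \<in> events" if "xs \<in> ?P" for xs
    using that by (intro order_event_measurable rv) (simp add: permutations_of_setD)
  obtain p where p: "prob (order_event W xs) = p" if "xs \<in> ?P" for xs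
    using prob_order_event_eq[OF indep D \<open>K \<noteq> {}\<close>] by blast
  have union: "prob (\<Union>xs\<in>Q. order_event W xs) = real (card Q) * p" if Q: "Q \<subseteq> ?P" for Q
  proof -
    have "prob (\<Union>xs\<in>Q. order_event W xs) = (\<Sum>xs\<in>Q. prob (order_event W xs))"
      using Q meas disjoint_family_on_mono[OF Q disjoint_order_events] finite_subset[OF Q]
      by (intro finite_measure_finite_Union) auto
    also have "\<dots> = (\<Sum>xs\<in>Q. p)" using Q p by (intro sum.cong) auto
    finally show ?thesis by simp
  qed
  have "AE \<omega> in M. \<omega> \<in> (\<Union>xs\<in>?P. order_event W xs)"
    using AE_inj_weights[OF indep D atomless \<open>finite K\<close>] AE_space
    by eventually_elim (use ex_order_event[OF \<open>finite K\<close>] in blast)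
  then have "prob (\<Union>xs\<in>?P. order_event W xs) = 1"
    using meas by (subst prob_eq_1) auto
  then have "fact (card K) * p = 1" using union[OF order_refl] \<open>finite K\<close> by simp
  then have "p = 1 / fact (card K)" by (simp add: field_simps)
  then show ?thesis using union[OF P] by simp
qed

end

section \<open>Events about the minimum spanning tree\<close>

lemma mst_measurable:
  fixes W :: "'v set \<Rightarrow> 'a \<Rightarrow> real"
  assumes "finite V" and rv: "\<And>g. g \<in> complete_edges V \<Longrightarrow> W g \<in> borel_measurable M"
  shows "{\<omega> \<in> space M. Q (mst V (complete_edges V) (\<lambda>g. W g \<omega>))} \<in> sets M"
proof -
  let ?K = "complete_edges V"
  have finP: "finite (Pow ?K)" using finite_complete_edges[OF assms(1)] by simp
  let ?C = "\<lambda>\<omega>. {T. is_mst V ?K (\<lambda>g. W g \<omega>) T}"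
  have sub: "?C \<omega> \<subseteq> Pow ?K" for \<omega> by (auto simp: is_mst_def spanning_tree_def)
  have sum: "(\<lambda>\<omega>. \<Sum>g\<in>T. W g \<omega>) \<in> borel_measurable M" if "T \<in> Pow ?K" for T
    using that rv by (intro borel_measurable_sum) auto
  have mst: "{\<omega> \<in> space M. is_mst V ?K (\<lambda>g. W g \<omega>) T} \<in> sets M" if "T \<in> Pow ?K" for T
  proof -
    have "{\<omega> \<in> space M. is_mst V ?K (\<lambda>g. W g \<omega>) T} = {\<omega> \<in> space M. spanning_tree V ?K T \<and>
        (\<forall>T'\<in>Pow ?K. spanning_tree V ?K T' \<longrightarrow> (\<Sum>g\<in>T. W g \<omega>) \<le> (\<Sum>g\<in>T'. W g \<omega>))}"
      by (auto simp: is_mst_def spanning_tree_def)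
    also have "\<dots> \<in> sets M"
      using that by (intro sets.sets_Collect sets.sets_Collect_finite_All finP borel_measurable_le sum) auto
    finally show ?thesis .
  qed
  \<comment> \<open>The set of all minimum spanning trees takes finitely many values
    \<open>\<T>\<close>, each on a measurable event, and determines \<open>mst\<close> even where
    there are ties.\<close>
  have "{\<omega> \<in> space M. Q (mst V ?K (\<lambda>g. W g \<omega>))} =
      (\<Union>\<T>\<in>{\<T> \<in> Pow (Pow ?K). Q (THE T. T \<in> \<T>)}.
        {\<omega> \<in> space M. \<forall>T\<in>Pow ?K. T \<in> \<T> \<longleftrightarrow> is_mst V ?K (\<lambda>g. W g \<omega>) T})" (is "_ = (\<Union>\<T>\<in>?I. ?S \<T>)")
  proof -
    have "\<omega> \<in> ?S \<T> \<longleftrightarrow> \<omega> \<in> space M \<and> \<T> = ?C \<omega>" if "\<T> \<in> Pow (Pow ?K)" for \<omega> \<T>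
      using that sub[of \<omega>] by blast
    moreover have "mst V ?K (\<lambda>g. W g \<omega>) = (THE T. T \<in> ?C \<omega>)" for \<omega>
      by (simp add: mst_def)
    moreover have "?C \<omega> \<in> Pow (Pow ?K)" for \<omega> using sub by blast
    ultimately show ?thesis by auto
  qed
  also have "\<dots> \<in> sets M"
  proof (rule sets.finite_UN)
    show "finite ?I" using finP by simp
    fix \<T> assume "\<T> \<in> ?I"
    have "{\<omega> \<in> space M. T \<in> \<T> \<longleftrightarrow> is_mst V ?K (\<lambda>g. W g \<omega>) T} \<in> sets M" if "T \<in> Pow ?K" for T
      using mst[OF that] by (cases "T \<in> \<T>") (simp_all add: sets.sets_Collect_neg)
    then show "?S \<T> \<in> sets M" by (intro sets.sets_Collect_finite_All finP)
  qed
  finally show ?thesis .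
qed

text \<open>Almost surely the weights are distinct and follow some order \<open>xs\<close>; then
  \<open>mst\<close> is \<open>kruskal {} xs\<close>, so the event agrees, up to a null set, with a
  union of order events.\<close>

lemma (in prob_space) prob_mst_supset:
  assumes "finite V" and "complete_edges V \<noteq> {}"
    and indep: "indep_vars (\<lambda>_. borel) W (complete_edges V)"
    and D: "\<forall>g\<in>complete_edges V. distr M borel (W g) = D"
    and atomless: "\<And>x. measure D {x} = 0"
  shows "prob {\<omega> \<in> space M. S \<subseteq> mst V (complete_edges V) (\<lambda>g. W g \<omega>)} =
    real (count_orders V S) / fact (card (complete_edges V))"
proof -
  let ?K = "complete_edges V"
  let ?Q = "{xs \<in> permutations_of_set ?K. S \<subseteq> kruskal {} xs}"
  have finK: "finite ?K" using assms(1) by (rule finite_complete_edges)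
  have "V \<noteq> {}" using assms(2) by (auto elim: complete_edgesD)
  have rv: "random_variable borel (W g)" if "g \<in> ?K" for g
    using indep that by (simp add: indep_vars_def)
  have mst: "mst V ?K (\<lambda>g. W g \<omega>) = kruskal {} xs"
    if "inj_on (\<lambda>g. W g \<omega>) ?K" "xs \<in> permutations_of_set ?K" "\<omega> \<in> order_event W xs" for \<omega> xs
  proof -
    have "kruskal {} xs = kruskal_tree V (\<lambda>g. W g \<omega>)"
      using that(2,3) kruskal_sorted[of "\<lambda>g. W g \<omega>" xs "{}"]
      by (simp add: order_event_def kruskal_tree_def permutations_of_setD)
    then show ?thesis
      unfolding mst_def is_mst_iff[OF assms(1) \<open>V \<noteq> {}\<close> that(1)] by simp
  qed
  have "AE \<omega> in M. (\<omega> \<in> {\<omega> \<in> space M. S \<subseteq> mst V ?K (\<lambda>g. W g \<omega>)}) = (\<omega> \<in> (\<Union>xs\<in>?Q. order_event W xs))"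
    using AE_inj_weights[OF indep D atomless finK] AE_space
  proof eventually_elim
    case (elim \<omega>)
    then obtain xs where xs: "xs \<in> permutations_of_set ?K" "\<omega> \<in> order_event W xs"
      using ex_order_event[OF finK] by blast
    \<comment> \<open>Orders whose events share \<open>\<omega>\<close> accept the same edges,
      namely those of \<open>mst\<close>.\<close>
    have "S \<subseteq> kruskal {} xs" if "ys \<in> ?Q" "\<omega> \<in> order_event W ys" for ys
      using that mst[OF elim(1)] xs by (metis (mono_tags, lifting) mem_Collect_eq)
    then show ?case
      unfolding mem_Collect_eq mst[OF elim(1) xs] using xs elim(2) by blast
  qed
  then have "prob {\<omega> \<in> space M. S \<subseteq> mst V ?K (\<lambda>g. W g \<omega>)} = prob (\<Union>xs\<in>?Q. order_event W xs)"
    using mst_measurable[OF assms(1) rv, where Q = "\<lambda>T. S \<subseteq> T"]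
    by (intro finite_measure_eq_AE) (auto intro!: sets.finite_UN order_event_measurable rv simp: permutations_of_setD)
  also have "\<dots> = real (card ?Q) / fact (card ?K)"
    by (rule prob_order_event[OF indep D atomless finK assms(2)]) auto
  finally show ?thesis by (simp add: count_orders_def)
qed

theorem theoremB1:
  fixes M :: "'a measure"
    and V :: "'v set" and n :: nat
    and W :: "'v set \<Rightarrow> 'a \<Rightarrow> real"
    and D :: "real measure"
    and e f :: "'v set"
    and T :: "'a \<Rightarrow> 'v set set"
    and p0 p1 :: real
  assumes "prob_space M"
    and "finite V" and "card V = n" and "n \<ge> 3"
    and "e \<in> complete_edges V" and "f \<in> complete_edges V"
    and "e \<noteq> f" and "e \<inter> f \<noteq> {}"
    and "prob_space.indep_vars M (\<lambda>_. borel) W (complete_edges V)"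
    and "\<And>g. g \<in> complete_edges V \<Longrightarrow> distr M borel (W g) = D"
    and "\<And>x. measure D {x} = 0"
    and "T = (\<lambda>\<omega>. mst V (complete_edges V) (\<lambda>g. W g \<omega>))"
    and "p1 = measure M {\<omega> \<in> space M. e \<in> T \<omega> \<and> f \<in> T \<omega>}"
    and "p0 = measure M {\<omega> \<in> space M. e \<in> T \<omega>}"
  shows "(AE \<omega> in M. \<exists>!S. is_mst V (complete_edges V) (\<lambda>g. W g \<omega>) S)
    \<and> p0 = 2 / real n
    \<and> p1 < p0\<^sup>2
    \<and> p0\<^sup>2 = 4 / (real n)\<^sup>2"
proof -
  interpret prob_space M by fact
  let ?K = "complete_edges V"
  have "V \<noteq> {}" and K: "?K \<noteq> {}" using assms(3-5) by auto
  have adj: "(e, f) \<in> adjacent_pairs ?K" using assms(5-8) by (simp add: adjacent_pairs_def)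
  have card: "card V \<ge> 3" using assms(3,4) by simp
  have D: "\<forall>g\<in>?K. distr M borel (W g) = D" using assms(10) by blast
  \<comment> \<open>Taking \<open>{e}\<close> and \<open>{e, f}\<close> for \<open>S\<close> turns
    both probabilities into counts of edge orders.\<close>
  note prob = prob_mst_supset[OF assms(2) K assms(9) D assms(11)]
  have "AE \<omega> in M. \<exists>!S. is_mst V ?K (\<lambda>g. W g \<omega>) S"
    using AE_inj_weights[OF assms(9) D assms(11) finite_complete_edges[OF assms(2)]]
    by eventually_elim (simp add: is_mst_iff[OF assms(2) \<open>V \<noteq> {}\<close>])
  moreover have p0: "p0 = 2 / real n"
    using prob[of "{e}"] count_orders_edge[OF assms(2) card adj] by (simp add: assms(3,12,14))
  moreover have "p1 < 4 / (real n)\<^sup>2"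
    using prob[of "{e, f}"] count_orders_adjacent_less[OF assms(2) card adj]
    by (simp add: assms(3,12,13) pos_divide_less_eq)
  ultimately show ?thesis by (simp add: power_divide)
qed

end
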